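(* There is an algorithm that enumerates all Lyndon words of length exactly $n$ over $\Sigma=\{0,\dots,q-1\}$ in lexicographic order, maintaining the current word in compressed representation, such that the amortized number of updates per enumerated word (total number of updates divided by $\ell_n$) is at most $$\frac{3(\Lambda_n-L_n)+\ell_n}{\ell_n}=1+\frac{3q}{(q-1)^2}+o(1)\quad (n\to\infty).$$
   Context: $\Sigma=\{0,1,\dots,q-1\}$ with $0<1<\dots<q-1$ and lexicographic order on words. For $w=w_1\cdots w_n$, $R_i(w)=w_i\cdots w_nw_1\cdots w_{i-1}$; $w$ is a Lyndon word if $w<R_i(w)$ for all $2\le i\le n$. Let $\ell_m$ be the number of Lyndon words of length $m$ over $\Sigma$, $L_m=\ell_1+\cdots+\ell_m$, and $\Lambda_n=L_1+\cdots+L_n$. The compressed representation of $v\in\Sigma^n$ writes $v=v^{(0)}[q-1]^{i_1}v^{(1)}\cdots v^{(t-1)}[q-1]^{i_t}$ with $i_1,\dots,i_{t-1}\ge1$, $i_t\ge 0$ and $v^{(j)}$ nonempty words without the symbol $q-1$, stored as the array/list of cells $v^{(0)},i_1,v^{(1)},\dots,v^{(t-1)},i_t$ (omitting $i_t$ if $0$), each $v^{(j)}$ symbol by symbol and each $i_j$ as one number. An update is a change (modification, insertion or deletion) of one cell of this data structure. *)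

theory Defs
  imports Complex_Main "HOL-Library.Landau_Symbols"
begin

subsection \<open>Lyndon words\<close>

definition lex_less :: "nat list \<Rightarrow> nat list \<Rightarrow> bool" where
  "lex_less v w \<longleftrightarrow> (v, w) \<in> lexord {(a, b). a < b}"

text \<open>The conjugate \<open>w\<^sub>i \<dots> w\<^sub>n w\<^sub>1 \<dots> w\<^bsub>i-1\<^esub>\<close> is \<open>rotate (i - 1) w\<close>.\<close>

definition lyndon :: "nat list \<Rightarrow> bool" where
  "lyndon w \<longleftrightarrow> (\<forall>i\<in>{2..length w}. lex_less w (rotate (i - 1) w))"

definition lyndon_words :: "nat \<Rightarrow> nat \<Rightarrow> nat list set" where
  "lyndon_words q m = {w. length w = m \<and> set w \<subseteq> {..<q} \<and> lyndon w}"

definition num_lyndon :: "nat \<Rightarrow> nat \<Rightarrow> nat" where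
  "num_lyndon q m = card (lyndon_words q m)"

definition sum_lyndon :: "nat \<Rightarrow> nat \<Rightarrow> nat" where
  "sum_lyndon q m = (\<Sum>k=1..m. num_lyndon q k)"

definition sumsum_lyndon :: "nat \<Rightarrow> nat \<Rightarrow> nat" where
  "sumsum_lyndon q n = (\<Sum>k=1..n. sum_lyndon q k)"


subsection \<open>Compressed representation\<close>

text \<open>A cell holds either one symbol different from \<open>q - 1\<close>, or the length of a maximal
  run of symbols \<open>q - 1\<close>.\<close>

datatype cell = Sym nat | Run nat

fun compress :: "nat \<Rightarrow> nat list \<Rightarrow> cell list" where
  "compress q [] = []"
| "compress q (a # w) =
     (if a \<noteq> q - 1 then Sym a # compress q w
      else (case compress q w of
              Run i # cs \<Rightarrow> Run (Suc i) # cs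
            | cs \<Rightarrow> Run 1 # cs))"

lemma compress_append_syms:
  "q - 1 \<notin> set u \<Longrightarrow> compress q (u @ w) = map Sym u @ compress q w"
  by (induction u) auto

lemma compress_append_run:
  assumes "\<And>i cs. compress q w \<noteq> Run i # cs"
  shows "compress q (replicate i (q - 1) @ w) = (if i = 0 then [] else [Run i]) @ compress q w"
proof (induction i)
  case (Suc i)
  then show ?case using assms by (auto split: list.split cell.split)
qed simp

text \<open>The word \<open>v\<^bsup>(0)\<^esup> [q-1]\<^bsup>i\<^sub>1\<^esup> v\<^bsup>(1)\<^esup> \<dots> v\<^bsup>(t-1)\<^esup> [q-1]\<^bsup>i\<^sub>t\<^esup>\<close> is given by the list of pairs
  \<open>(v\<^bsup>(j)\<^esup>, i\<^bsub>j+1\<^esub>)\<close>. The words not of this form are those starting with \<open>q - 1\<close>; the only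
  Lyndon word among them is the one-letter word \<open>q - 1\<close>, for which \<open>compress\<close> gives the
  single cell \<open>Run 1\<close>.\<close>

lemma compress_blocks:
  fixes bs :: "(nat list \<times> nat) list"
  assumes "\<forall>(u, i)\<in>set bs. u \<noteq> [] \<and> q - 1 \<notin> set u"
    and "\<forall>(u, i)\<in>set (butlast bs). i \<ge> 1"
  shows "compress q (concat (map (\<lambda>(u, i). u @ replicate i (q - 1)) bs)) =
    concat (map (\<lambda>(u, i). map Sym u @ (if i = 0 then [] else [Run i])) bs)"
  using assms
proof (induction bs)
  case (Cons b bs)
  obtain u i where b: "b = (u, i)" by (cases b)
  let ?w = "concat (map (\<lambda>(u, i). u @ replicate i (q - 1)) bs)"
  have IH: "compress q ?w =
      concat (map (\<lambda>(u, i). map Sym u @ (if i = 0 then [] else [Run i])) bs)"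
    using Cons by (auto split: if_splits)
  have "compress q ?w \<noteq> Run k # cs" for k cs
  proof (cases bs)
    case (Cons b' bs')
    obtain u' i' where b': "b' = (u', i')" by (cases b')
    with \<open>bs = b' # bs'\<close> Cons.prems have "u' \<noteq> []" by auto
    then obtain a u'' where "u' = a # u''" by (cases u') auto
    then show ?thesis unfolding IH using \<open>bs = b' # bs'\<close> b' by simp
  qed simp
  from compress_append_run[OF this] have
    "compress q (replicate i (q - 1) @ ?w) = (if i = 0 then [] else [Run i]) @ compress q ?w" .
  moreover have "q - 1 \<notin> set u" using Cons.prems b by auto
  ultimately show ?case using b IH by (simp add: compress_append_syms)
qed simp


subsection \<open>Algorithms on the compressed representation\<close>

text \<open>An algorithm is a program in an imperative language with registers for natural numbers
  and one list of cells. \<open>Insert\<close>, \<open>Modify\<close> and \<open>Delete\<close> are the only commands that change the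
  list; each changes one cell and counts as one update. \<open>Emit\<close> enumerates the word that
  the list represents at that moment. Registers, reading and control flow are not counted.\<close>

datatype aexp = Num nat | Reg nat | Add aexp aexp | Sub aexp aexp | NumCells | CellVal aexp

datatype bexp = Less aexp aexp | Neg bexp | Conj bexp bexp | IsRun aexp

datatype cexp = SymC aexp | RunC aexp

datatype com =
    Skip
  | Assign nat aexp
  | Seq com com
  | Cond bexp com com
  | While bexp com
  | Insert aexp cexp
  | Modify aexp cexp
  | Delete aexp
  | Emit

record state =
  regs :: "nat \<Rightarrow> nat"
  cells :: "cell list"
  updates :: nat
  emitted :: "cell list list"

fun cell_val :: "cell \<Rightarrow> nat" where
  "cell_val (Sym a) = a"
| "cell_val (Run i) = i"

fun aval :: "aexp \<Rightarrow> state \<Rightarrow> nat" where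
  "aval (Num k) s = k"
| "aval (Reg x) s = regs s x"
| "aval (Add a b) s = aval a s + aval b s"
| "aval (Sub a b) s = aval a s - aval b s"
| "aval NumCells s = length (cells s)"
| "aval (CellVal a) s =
     (if aval a s < length (cells s) then cell_val (cells s ! aval a s) else 0)"

fun bval :: "bexp \<Rightarrow> state \<Rightarrow> bool" where
  "bval (Less a b) s \<longleftrightarrow> aval a s < aval b s"
| "bval (Neg b) s \<longleftrightarrow> \<not> bval b s"
| "bval (Conj b c) s \<longleftrightarrow> bval b s \<and> bval c s"
| "bval (IsRun a) s \<longleftrightarrow> aval a s < length (cells s) \<and> (\<exists>i. cells s ! aval a s = Run i)"

fun cval :: "cexp \<Rightarrow> state \<Rightarrow> cell" where
  "cval (SymC a) s = Sym (aval a s)"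
| "cval (RunC a) s = Run (aval a s)"

text \<open>\<open>exec c s t\<close>: started in \<open>s\<close>, the program \<open>c\<close> terminates in \<open>t\<close>. A program gets stuck
  if it addresses a cell to be changed that does not exist.\<close>

inductive exec :: "com \<Rightarrow> state \<Rightarrow> state \<Rightarrow> bool" where
  Skip: "exec Skip s s"
| Assign: "exec (Assign x a) s (s\<lparr>regs := (regs s)(x := aval a s)\<rparr>)"
| Seq: "exec c s t \<Longrightarrow> exec d t u \<Longrightarrow> exec (Seq c d) s u"
| CondTrue: "bval b s \<Longrightarrow> exec c s t \<Longrightarrow> exec (Cond b c d) s t"
| CondFalse: "\<not> bval b s \<Longrightarrow> exec d s t \<Longrightarrow> exec (Cond b c d) s t"
| WhileFalse: "\<not> bval b s \<Longrightarrow> exec (While b c) s s"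
| WhileTrue: "bval b s \<Longrightarrow> exec c s t \<Longrightarrow> exec (While b c) t u \<Longrightarrow> exec (While b c) s u"
| Insert: "aval a s \<le> length (cells s) \<Longrightarrow>
    exec (Insert a e) s
      (s\<lparr>cells := take (aval a s) (cells s) @ cval e s # drop (aval a s) (cells s),
         updates := Suc (updates s)\<rparr>)"
| Modify: "aval a s < length (cells s) \<Longrightarrow>
    exec (Modify a e) s
      (s\<lparr>cells := (cells s)[aval a s := cval e s], updates := Suc (updates s)\<rparr>)"
| Delete: "aval a s < length (cells s) \<Longrightarrow>
    exec (Delete a) s
      (s\<lparr>cells := take (aval a s) (cells s) @ drop (Suc (aval a s)) (cells s),
         updates := Suc (updates s)\<rparr>)"
| Emit: "exec Emit s (s\<lparr>emitted := emitted s @ [cells s]\<rparr>)"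

inductive_cases SkipE: "exec Skip s t"
inductive_cases AssignE: "exec (Assign x a) s t"
inductive_cases SeqE: "exec (Seq c d) s t"
inductive_cases CondE: "exec (Cond b c d) s t"
inductive_cases WhileE: "exec (While b c) s t"
inductive_cases InsertE: "exec (Insert a e) s t"
inductive_cases ModifyE: "exec (Modify a e) s t"
inductive_cases DeleteE: "exec (Delete a) s t"
inductive_cases EmitE: "exec Emit s t"

lemma exec_deterministic: "exec c s t \<Longrightarrow> exec c s t' \<Longrightarrow> t = t'"
proof (induction arbitrary: t' rule: exec.induct)
  case (WhileTrue b s c t u)
  from WhileTrue.prems show ?case
    by (rule WhileE) (use WhileTrue.hyps WhileTrue.IH in blast)+
qed (blast elim: SkipE AssignE SeqE CondE WhileE InsertE ModifyE DeleteE EmitE)+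

text \<open>The input \<open>q\<close>, \<open>n\<close> is in registers 0 and 1; the list of cells is initially empty, so
  that building the first word is counted as well.\<close>

definition init_state :: "nat \<Rightarrow> nat \<Rightarrow> state" where
  "init_state q n =
     \<lparr>regs = (\<lambda>_. 0)(0 := q, 1 := n), cells = [], updates = 0, emitted = []\<rparr>"

definition enumerates_lyndon :: "nat \<Rightarrow> nat \<Rightarrow> state \<Rightarrow> bool" where
  "enumerates_lyndon q n s \<longleftrightarrow>
     (\<exists>ws. sorted_wrt lex_less ws \<and> set ws = lyndon_words q n \<and>
           emitted s = map (compress q) ws)"

end

theory Submission
  imports Defs "HOL-Analysis.Uniform_Limit" "HOL-Real_Asymp.Real_Asymp"
begin

text \<open>The program is Duval's algorithm, which runs through the Lyndon words of length at most
  \<open>n\<close> in lexicographic order. The successor of \<open>w\<close> is obtained by continuing \<open>w\<close> periodically to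
  length \<open>n\<close>, removing the trailing letters \<open>q - 1\<close> and incrementing the last remaining letter.
  If \<open>w\<close> is shorter than \<open>n\<close>, the cut is computed in advance, so that letters are only appended,
  each with one update. If \<open>w\<close> has length \<open>n\<close>, the trailing run is one cell to be deleted, and
  the incremented letter is one cell to be modified, or deleted and merged with the run before
  it.

  Since \<open>\<Lambda>\<^sub>n - L\<^sub>n\<close> is the sum of \<open>n - |w|\<close> over these words, the bound is proved by giving
  \<open>w\<close> the budget \<open>3 (n - |w|)\<close>, plus 1 if \<open>|w| = n\<close>. A deletion or merge on reaching a word
  shorter than \<open>n\<close> is paid by that word; a merge on reaching a word of length \<open>n\<close> creates a run of
  length at least 2 and is paid by the next word, which is at least 2 letters shorter than \<open>n\<close>.

  For the asymptotics, \<open>q\<^sup>n - n q\<^bsup>n div 2\<^esup> \<le> n \<ell>\<^sub>n \<le> q\<^sup>n\<close>, and then \<open>(\<Lambda>\<^sub>n - L\<^sub>n) / \<ell>\<^sub>n\<close>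
  converges to \<open>\<Sum>k. k / q\<^sup>k = q / (q - 1)\<^sup>2\<close> by Tannery's theorem.\<close>

subsection \<open>Lyndon words and Duval's successor\<close>

lemma lex_less_nth:
  "lex_less v w \<longleftrightarrow>
     length v < length w \<and> (\<forall>i<length v. v ! i = w ! i) \<or>
     (\<exists>i<min (length v) (length w). (\<forall>k<i. v ! k = w ! k) \<and> v ! i < w ! i)"
proof -
  have "take (length v) w = v \<longleftrightarrow> (\<forall>i<length v. v ! i = w ! i)" if "length v < length w"
    using that by (auto simp: list_eq_iff_nth_eq)
  moreover have "take i v = take i w \<longleftrightarrow> (\<forall>k<i. v ! k = w ! k)"
    if "i < min (length v) (length w)" for i
    using that by (auto simp: list_eq_iff_nth_eq)
  ultimately show ?thesis
    unfolding lex_less_def lexord_take_index_conv by auto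
qed

lemma lex_less_irrefl: "\<not> lex_less v v"
  by (auto simp: lex_less_nth)

lemma lex_less_trans: "lex_less u v \<Longrightarrow> lex_less v w \<Longrightarrow> lex_less u w"
  unfolding lex_less_def by (rule lexord_trans) (auto simp: trans_def)

lemma lex_less_total: "lex_less v w \<or> v = w \<or> lex_less w v"
  unfolding lex_less_def by (rule lexord_linear) (auto simp: nat_neq_iff)

lemma lex_less_asym: "lex_less v w \<Longrightarrow> \<not> lex_less w v"
  using lex_less_irrefl lex_less_trans by blast

lemma lex_less_same_length:
  assumes "length v = length w"
  shows "lex_less v w \<longleftrightarrow> (\<exists>i<length v. (\<forall>k<i. v ! k = w ! k) \<and> v ! i < w ! i)"
  using assms by (simp add: lex_less_nth)

lemma lex_less_append:
  "length v = length w \<Longrightarrow> lex_less v w \<Longrightarrow> lex_less (v @ x) (w @ y)"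
  unfolding lex_less_nth by (fastforce simp: nth_append)

section \<open>Rotations, first letters and periods of Lyndon words\<close>

lemma lyndon_iff_rotate:
  "lyndon w \<longleftrightarrow> (\<forall>i. 0 < i \<and> i < length w \<longrightarrow> lex_less w (rotate i w))"
proof -
  have "(\<forall>i\<in>{2..length w}. P (i - 1)) \<longleftrightarrow> (\<forall>i. 0 < i \<and> i < length w \<longrightarrow> P i)" for P
  proof (intro iffI allI impI ballI)
    fix i assume *: "\<forall>i\<in>{2..length w}. P (i - 1)" and "0 < i \<and> i < length w"
    then show "P i" using bspec[OF *, of "Suc i"] by simp
  qed auto
  then show ?thesis unfolding lyndon_def .
qed

lemma lyndon_nth:
  "lyndon w \<longleftrightarrow> (\<forall>i. 0 < i \<and> i < length w \<longrightarrow>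
     (\<exists>t<length w. (\<forall>k<t. w ! k = w ! ((i + k) mod length w)) \<and>
        w ! t < w ! ((i + t) mod length w)))"
proof -
  have "lex_less w (rotate i w) \<longleftrightarrow>
     (\<exists>t<length w. (\<forall>k<t. w ! k = w ! ((i + k) mod length w)) \<and>
        w ! t < w ! ((i + t) mod length w))" for i
    by (simp add: lex_less_same_length nth_rotate cong: conj_cong)
  then show ?thesis unfolding lyndon_iff_rotate by simp
qed

lemma lyndonD_nth:
  assumes "lyndon w" "0 < i" "i < length w"
  obtains t where "t < length w" "\<And>k. k < t \<Longrightarrow> w ! k = w ! ((i + k) mod length w)"
    "w ! t < w ! ((i + t) mod length w)"
  using assms unfolding lyndon_nth by blast

lemma lyndon_hd_le:
  assumes "lyndon w" "k < length w"
  shows "w ! 0 \<le> w ! k"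
proof (cases "k = 0")
  case False
  then obtain t where "\<And>j. j < t \<Longrightarrow> w ! j = w ! ((k + j) mod length w)"
    "w ! t < w ! ((k + t) mod length w)"
    using assms by (elim lyndonD_nth) auto
  with assms show ?thesis by (cases t) force+
qed simp

text \<open>By \<open>lyndon_hd_le\<close> all letters equal \<open>q - 1\<close>, which excludes a
  strict mismatch with the rotation by one. This identifies the last word of the
  enumeration.\<close>

lemma lyndon_max_hd:
  assumes "lyndon w" "w \<noteq> []" "set w \<subseteq> {..<q}" "w ! 0 = q - 1"
  shows "w = [q - 1]"
proof (cases "length w = 1")
  case True
  with assms(4) show ?thesis by (cases w) auto
next
  case False
  with assms(2) have "1 < length w" by (cases w) auto
  then obtain t where t: "t < length w" "w ! t < w ! ((1 + t) mod length w)"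
    using assms(1) by (elim lyndonD_nth) auto
  have "(1 + t) mod length w < length w" using assms(2) by simp
  then have "w ! ((1 + t) mod length w) < q" using assms(3) by (meson lessThan_iff nth_mem subsetD)
  moreover have "q - 1 \<le> w ! t" using lyndon_hd_le[OF assms(1) t(1)] assms(4) by simp
  ultimately show ?thesis using t(2) by simp
qed

text \<open>Lyndon words are unbordered: a period \<open>p\<close> gives
  \<open>v = r @ u = u @ s\<close>, and comparing \<open>v\<close> with its rotations
  \<open>u @ r\<close> and \<open>s @ u\<close> yields both s < r and r < s.\<close>

lemma lyndon_no_period:
  assumes "lyndon v" "0 < p" "p < length v"
  shows "\<exists>t<length v - p. v ! (p + t) \<noteq> v ! t"
proof (rule ccontr)
  assume "\<not> ?thesis"
  then have per: "v ! (p + t) = v ! t" if "t < length v - p" for t using that by auto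
  define u where "u = drop p v"
  define r where "r = take p v"
  define s where "s = drop (length v - p) v"
  have u: "u = take (length v - p) v"
    unfolding u_def using assms(3) by (auto simp: list_eq_iff_nth_eq per)
  have vr: "v = r @ u" by (simp add: r_def u_def)
  have vs: "v = u @ s" unfolding u s_def by simp
  have len: "length r = p" "length s = p" "length u = length v - p"
    using assms(3) by (auto simp: r_def s_def u)
  have "rotate p v = u @ r" using vr len(1) rotate_append[of r u] by simp
  then have "lex_less (u @ s) (u @ r)"
    using assms vs unfolding lyndon_iff_rotate by metis
  then have "lex_less s r" by (simp add: lex_less_def lexord_same_pref_iff)
  have "rotate (length v - p) v = s @ u" using vs len(3) rotate_append[of u s] by simp
  moreover have "0 < length v - p" "length v - p < length v" using assms(2,3) by auto
  ultimately have less: "lex_less (r @ u) (s @ u)"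
    using assms(1) vr unfolding lyndon_iff_rotate by metis
  have "\<not> lex_less (s @ u) (r @ u)" "s @ u \<noteq> r @ u"
    using less lex_less_asym lex_less_irrefl by metis+
  then have "lex_less r s"
    using lex_less_total[of r s] lex_less_append[of s r u u] len by auto
  with \<open>lex_less s r\<close> show False using lex_less_asym by blast
qed

section \<open>Duval's successor: Lyndon property and minimality\<close>

text \<open>Against the suffix starting at \<open>i\<close>, either the mismatch inherited from a
  rotation of \<open>w\<close> decides, or there is agreement up to the end of the suffix, where
  \<open>b\<close> exceeds its counterpart.\<close>

lemma lyndon_increment:
  assumes "lyndon w" "w \<noteq> []" "b > w ! (l mod length w)"
  shows "lyndon (map (\<lambda>j. w ! (j mod length w)) [0..<l] @ [b])"
proof -
  define m where "m = length w"
  define x where "x j = w ! (j mod m)" for j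
  define w' where "w' = map x [0..<l] @ [b]"
  have len: "length w' = Suc l" by (simp add: w'_def)
  have nth: "w' ! j = x j" if "j < l" for j using that by (simp add: w'_def nth_append)
  have last: "w' ! l = b" by (simp add: w'_def nth_append)
  have b: "x l < b" using assms(3) by (simp add: x_def m_def)
  \<comment> \<open>The bound \<open>l - i\<close> keeps the mismatch before the wrap-around, so it
    also settles the comparison with the rotation.\<close>
  have key: "\<exists>t\<le>l - i. (\<forall>k<t. w' ! k = w' ! (i + k)) \<and> w' ! t < w' ! (i + t)"
    if i: "0 < i" "i \<le> l" for i
  proof (cases "i mod m = 0")
    case True
    then have per: "x (i + k) = x k" for k unfolding x_def by (metis add_0 mod_add_left_eq)
    have "w' ! (l - i) = x (i + (l - i))" unfolding per using i nth[of "l - i"] by simp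
    then have "w' ! (l - i) < w' ! (i + (l - i))" using i b last by simp
    moreover have "w' ! k = w' ! (i + k)" if "k < l - i" for k
      using that i nth[of k] nth[of "i + k"] per by simp
    ultimately show ?thesis by blast
  next
    case False
    then obtain t where t: "\<And>k. k < t \<Longrightarrow> w ! k = w ! ((i mod m + k) mod m)"
      "w ! t < w ! ((i mod m + t) mod m)" "t < m"
      using assms(1,2) lyndonD_nth[of w "i mod m"] unfolding m_def by auto
    have eq: "x k = x (i + k)" if "k < t" for k
      using t(1)[OF that] t(3) that by (simp add: x_def mod_add_left_eq)
    have lt: "x t < x (i + t)"
      using t(2,3) by (simp add: x_def mod_add_left_eq)
    show ?thesis
    proof (cases "t < l - i")
      case True
      then show ?thesis using eq lt nth by (intro exI[of _ t]) auto
    next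
      case False
      have "x (l - i) \<le> x (i + (l - i))"
        using False eq[of "l - i"] lt by (cases "t = l - i") auto
      then have "w' ! (l - i) < w' ! (i + (l - i))" using i b last nth[of "l - i"] by simp
      moreover have "w' ! k = w' ! (i + k)" if "k < l - i" for k
        using that i nth[of k] nth[of "i + k"] eq[of k] False by simp
      ultimately show ?thesis by blast
    qed
  qed
  have "lyndon w'"
    unfolding lyndon_nth len
  proof (intro allI impI)
    fix i assume i: "0 < i \<and> i < Suc l"
    then obtain t where t: "t \<le> l - i" "\<forall>k<t. w' ! k = w' ! (i + k)" "w' ! t < w' ! (i + t)"
      using key[of i] by auto
    then show "\<exists>t<Suc l. (\<forall>k<t. w' ! k = w' ! ((i + k) mod Suc l)) \<and>
        w' ! t < w' ! ((i + t) mod Suc l)"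
      using i by (intro exI[of _ t]) auto
  qed
  then show ?thesis by (simp add: w'_def x_def[abs_def] m_def)
qed

text \<open>If \<open>v\<close> followed w w w ... throughout, it would be a prefix of
  \<open>w\<close> or have period \<open>length w\<close>. So there is a first difference, and it
  has to go upwards.\<close>

lemma lyndon_greater_periodic:
  assumes "lyndon w" "w \<noteq> []" "lyndon v" "lex_less w v"
  obtains j where "j < length v" "\<And>k. k < j \<Longrightarrow> v ! k = w ! (k mod length w)"
    "w ! (j mod length w) < v ! j"
proof -
  define m where "m = length w"
  define x where "x j = w ! (j mod m)" for j
  have xm: "x (m + k) = x k" for k by (simp add: x_def)
  have xw: "x k = w ! k" if "k < m" for k using that by (simp add: x_def)
  have "m > 0" using assms(2) by (simp add: m_def)
  have "\<exists>j<length v. v ! j \<noteq> x j"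
  proof (rule ccontr)
    assume "\<not> ?thesis"
    then have eq: "v ! j = x j" if "j < length v" for j using that by auto
    show False
    proof (cases "length v \<le> m")
      case True
      then show False using assms(4) eq xw by (auto simp: lex_less_nth m_def)
    next
      case False
      with \<open>m > 0\<close> obtain t where "t < length v - m" "v ! (m + t) \<noteq> v ! t"
        using lyndon_no_period[OF assms(3), of m] by auto
      then show False using eq[of t] eq[of "m + t"] xm by simp
    qed
  qed
  then obtain j where j: "j < length v" "v ! j \<noteq> x j"
    and min: "\<And>k. k < j \<Longrightarrow> v ! k = x k"
    using exists_least_iff[of "\<lambda>j. j < length v \<and> v ! j \<noteq> x j"] by (metis order_less_trans)
  have "\<not> v ! j < x j"
  proof
    assume lt: "v ! j < x j"
    show False
    proof (cases "j < m")
      case True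
      then have "lex_less v w"
        unfolding lex_less_nth using lt j(1) min xw by (auto simp: m_def)
      then show False using assms(4) lex_less_asym by blast
    next
      \<comment> \<open>From position \<open>m\<close> on, \<open>v\<close> repeats its own
        beginning until the downward difference at \<open>j\<close>; its rotation by
        \<open>m\<close> would be smaller than \<open>v\<close>.\<close>
      case False
      with j(1) \<open>m > 0\<close> obtain t where t: "\<And>k. k < t \<Longrightarrow> v ! k = v ! ((m + k) mod length v)"
        "v ! t < v ! ((m + t) mod length v)"
        using lyndonD_nth[OF assms(3), of m] by auto
      have j': "v ! (j - m) = x j" using min[of "j - m"] False xm[of "j - m"] \<open>m > 0\<close> by simp
      consider "t < j - m" | "t = j - m" | "j - m < t" by linarith
      then show False
      proof cases
        case 1
        then show False using t(2) min[of t] min[of "m + t"] xm[of t] j(1) by simp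
      next
        case 2
        then show False using t(2) j' lt j(1) False by simp
      next
        case 3
        then show False using t(1)[OF 3] j' lt j(1) False by simp
      qed
    qed
  qed
  with j(2) have "x j < v ! j" by simp
  with j(1) min show ?thesis using that by (simp add: x_def m_def)
qed

text \<open>This is Duval's successor of \<open>w\<close> if \<open>l\<close> is the last position below \<open>n\<close> at which the
  periodic word \<open>w w w \<dots>\<close> has a letter other than \<open>q - 1\<close>.\<close>

definition duval_next :: "nat list \<Rightarrow> nat \<Rightarrow> nat list" where
  "duval_next w l = map (\<lambda>j. w ! (j mod length w)) [0..<l] @ [Suc (w ! (l mod length w))]"

lemma length_duval_next [simp]: "length (duval_next w l) = Suc l"
  by (simp add: duval_next_def)

lemma nth_duval_next: "j < l \<Longrightarrow> duval_next w l ! j = w ! (j mod length w)"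
  by (simp add: duval_next_def nth_append)

lemma nth_duval_next_last: "duval_next w l ! l = Suc (w ! (l mod length w))"
  by (simp add: duval_next_def nth_append)

lemma lyndon_duval_next: "lyndon w \<Longrightarrow> w \<noteq> [] \<Longrightarrow> lyndon (duval_next w l)"
  unfolding duval_next_def by (rule lyndon_increment) auto

lemma set_duval_next:
  assumes "w \<noteq> []" "set w \<subseteq> {..<q}" "w ! (l mod length w) < q - 1"
  shows "set (duval_next w l) \<subseteq> {..<q}"
proof -
  have "w ! (j mod length w) < q" for j
    using assms(1,2) by (meson length_greater_0_conv lessThan_iff mod_less_divisor nth_mem subsetD)
  then show ?thesis using assms(3) by (auto simp: duval_next_def)
qed

lemma lex_less_duval_next:
  assumes "w \<noteq> []"
  shows "lex_less w (duval_next w l)"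
proof (cases "l < length w")
  case True
  then show ?thesis unfolding lex_less_nth
    by (intro disjI2 exI[of _ l]) (simp add: nth_duval_next nth_duval_next_last)
next
  case False
  then show ?thesis unfolding lex_less_nth by (intro disjI1) (simp add: nth_duval_next)
qed

text \<open>Past \<open>l\<close> the periodic word has only maximal letters, so \<open>v\<close>
  rises above it at some j <= l. The least such word rises as late as possible, by one, and ends
  there.\<close>

lemma duval_next_le:
  assumes "lyndon w" "w \<noteq> []" "lyndon v" "lex_less w v"
    and "set v \<subseteq> {..<q}" "length v \<le> n"
    and tail: "\<And>j. l < j \<Longrightarrow> j < n \<Longrightarrow> w ! (j mod length w) = q - 1"
  shows "v = duval_next w l \<or> lex_less (duval_next w l) v"
proof -
  obtain j where j: "j < length v" "\<And>k. k < j \<Longrightarrow> v ! k = w ! (k mod length w)"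
    "w ! (j mod length w) < v ! j"
    using lyndon_greater_periodic[OF assms(1-4)] by blast
  have "v ! j < q" using j(1) assms(5) by (meson lessThan_iff nth_mem subsetD)
  then have "j \<le> l" using tail[of j] j(1,3) assms(6) by (cases "l < j") auto
  show ?thesis
  proof (cases "j = l \<and> v ! j = Suc (w ! (l mod length w))")
    case False
    then have "duval_next w l ! j < v ! j"
      using \<open>j \<le> l\<close> j(3) by (cases "j = l") (auto simp: nth_duval_next nth_duval_next_last)
    then have "lex_less (duval_next w l) v" unfolding lex_less_nth using j(1,2) \<open>j \<le> l\<close>
      by (intro disjI2 exI[of _ j]) (simp add: nth_duval_next)
    then show ?thesis ..
  next
    case True
    then have eq: "duval_next w l ! k = v ! k" if "k < Suc l" for k
      using that j(2) by (cases "k = l") (auto simp: nth_duval_next nth_duval_next_last)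
    show ?thesis
    proof (cases "length v = Suc l")
      case True
      then show ?thesis using eq by (auto simp: list_eq_iff_nth_eq)
    next
      case False
      then have "lex_less (duval_next w l) v"
        unfolding lex_less_nth using eq j(1) True by (intro disjI1) auto
      then show ?thesis ..
    qed
  qed
qed

subsection \<open>Compressed words\<close>

fun expand :: "nat \<Rightarrow> cell \<Rightarrow> nat list" where
  "expand q (Sym a) = [a]"
| "expand q (Run i) = replicate i (q - 1)"

definition decompress :: "nat \<Rightarrow> cell list \<Rightarrow> nat list" where
  "decompress q cs = concat (map (expand q) cs)"

lemma decompress_simps [simp]:
  "decompress q [] = []" "decompress q (c # cs) = expand q c @ decompress q cs"
  by (simp_all add: decompress_def)

lemma decompress_compress [simp]: "decompress q (compress q w) = w"
proof (induction w)
  case (Cons a w)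
  then show ?case by (auto split: list.split cell.split)
qed simp

text \<open>\<open>compress\<close> recurses from the front, while the program works at the end of
  the word; this and the later \<open>snoc\<close> lemmas supply the view from the end.\<close>

lemma compress_snoc_sym: "c \<noteq> q - 1 \<Longrightarrow> compress q (u @ [c]) = compress q u @ [Sym c]"
proof (induction u)
  case (Cons a u)
  then show ?case by (cases "compress q u") (auto split: cell.split)
qed simp

lemma compress_eq_Nil_iff [simp]: "compress q w = [] \<longleftrightarrow> w = []"
  by (cases w) (auto split: list.split cell.split)

lemma compress_last_run:
  "w \<noteq> [] \<Longrightarrow> (\<exists>i. last (compress q w) = Run i) \<longleftrightarrow> last w = q - 1"
proof (induction w)
  case (Cons a w)
  then show ?case
    by (cases "compress q w") (auto split: cell.split if_splits)
qed simp

lemma compress_snoc_max: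
  "compress q (u @ [q - 1]) =
     (if u \<noteq> [] \<and> last u = q - 1 then (compress q u)[length (compress q u) - 1 :=
        Run (Suc (cell_val (last (compress q u))))]
      else compress q u @ [Run 1])"
proof (induction u)
  case (Cons a u)
  show ?case
  proof (cases "u = []")
    case False
    then obtain c cs where "compress q u = c # cs" by (cases "compress q u") auto
    with Cons False show ?thesis using compress_last_run[OF False, of q]
      by (auto split: cell.split list.split nat.split simp: Let_def)
  qed simp
qed simp

text \<open>With \<open>lyndon_max_hd\<close> this makes \<open>IsRun (Num 0)\<close> a test for the
  last word.\<close>

lemma compress_hd_run:
  "w \<noteq> [] \<Longrightarrow> (\<exists>i. compress q w ! 0 = Run i) \<longleftrightarrow> w ! 0 = q - 1"
  by (cases w) (auto split: list.split cell.split)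

text \<open>Since \<open>a\<close> separates the trailing block from earlier runs, the block has a
  cell of its own and can be removed by one update.\<close>

lemma compress_snoc_run:
  assumes "a \<noteq> q - 1"
  shows "compress q (u @ [a] @ replicate (Suc r) (q - 1)) = compress q (u @ [a]) @ [Run (Suc r)]"
proof (induction r)
  case 0
  show ?case using assms compress_snoc_max[of q "u @ [a]"] by simp
next
  case (Suc r)
  have "compress q (u @ [a] @ replicate (Suc (Suc r)) (q - 1))
      = compress q ((u @ [a] @ replicate (Suc r) (q - 1)) @ [q - 1])"
    by (simp add: replicate_append_same)
  also have "\<dots> = compress q (u @ [a]) @ [Run (Suc (Suc r))]"
    unfolding compress_snoc_max Suc by simp
  finally show ?case .
qed

subsection \<open>Weakest preconditions and the program\<close>

text \<open>Total correctness: the execution claimed to exist terminates without getting stuck, and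
  by \<open>exec_deterministic\<close> it is the only one.\<close>

definition wp :: "com \<Rightarrow> (state \<Rightarrow> bool) \<Rightarrow> state \<Rightarrow> bool" where
  "wp c Q s \<longleftrightarrow> (\<exists>t. exec c s t \<and> Q t)"

lemma wp_Skip [simp]: "wp Skip Q s \<longleftrightarrow> Q s"
  unfolding wp_def by (blast intro: exec.intros elim: SkipE)

lemma wp_Assign [simp]: "wp (Assign x a) Q s \<longleftrightarrow> Q (s\<lparr>regs := (regs s)(x := aval a s)\<rparr>)"
  unfolding wp_def by (blast intro: exec.intros elim: AssignE)

lemma wp_Seq [simp]: "wp (Seq c d) Q = wp c (wp d Q)"
  unfolding wp_def by (blast intro: exec.intros elim: SeqE)

lemma wp_Cond [simp]: "wp (Cond b c d) Q s \<longleftrightarrow> (if bval b s then wp c Q s else wp d Q s)"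
  unfolding wp_def by (auto intro: exec.intros elim: CondE)

lemma wp_Insert [simp]: "wp (Insert a e) Q s \<longleftrightarrow> aval a s \<le> length (cells s) \<and>
    Q (s\<lparr>cells := take (aval a s) (cells s) @ cval e s # drop (aval a s) (cells s),
         updates := Suc (updates s)\<rparr>)"
  unfolding wp_def by (blast intro: exec.intros elim: InsertE)

lemma wp_Modify [simp]: "wp (Modify a e) Q s \<longleftrightarrow> aval a s < length (cells s) \<and>
    Q (s\<lparr>cells := (cells s)[aval a s := cval e s], updates := Suc (updates s)\<rparr>)"
  unfolding wp_def by (blast intro: exec.intros elim: ModifyE)

lemma wp_Delete [simp]: "wp (Delete a) Q s \<longleftrightarrow> aval a s < length (cells s) \<and>
    Q (s\<lparr>cells := take (aval a s) (cells s) @ drop (Suc (aval a s)) (cells s),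
         updates := Suc (updates s)\<rparr>)"
  unfolding wp_def by (blast intro: exec.intros elim: DeleteE)

lemma wp_Emit [simp]: "wp Emit Q s \<longleftrightarrow> Q (s\<lparr>emitted := emitted s @ [cells s]\<rparr>)"
  unfolding wp_def by (blast intro: exec.intros elim: EmitE)

lemma wp_While:
  fixes f :: "state \<Rightarrow> nat"
  assumes "I s"
    and step: "\<And>s. I s \<Longrightarrow> bval b s \<Longrightarrow> wp c (\<lambda>t. I t \<and> f t < f s) s"
    and exit: "\<And>s. I s \<Longrightarrow> \<not> bval b s \<Longrightarrow> Q s"
  shows "wp (While b c) Q s"
  using assms(1)
proof (induction "f s" arbitrary: s rule: less_induct)
  case less
  show ?case
  proof (cases "bval b s")
    case True
    then obtain t where "exec c s t" "I t" "f t < f s"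
      using step[OF less.prems] unfolding wp_def by blast
    moreover from this have "wp (While b c) Q t" using less.hyps by blast
    ultimately show ?thesis using True unfolding wp_def by (blast intro: exec.WhileTrue)
  next
    case False
    then show ?thesis using exit less.prems unfolding wp_def by (blast intro: exec.WhileFalse)
  qed
qed

section \<open>Reading letters from the cells\<close>

definition same_store :: "state \<Rightarrow> state \<Rightarrow> bool" where
  "same_store s t \<longleftrightarrow> cells t = cells s \<and> updates t = updates s \<and> emitted t = emitted s"

definition load_width :: com where
  "load_width = Cond (IsRun (Reg 7)) (Assign 9 (CellVal (Reg 7))) (Assign 9 (Num 1))"

text \<open>Reads the letter at position \<open>a\<close> of the represented word into register 6, walking
  through the cells (index in register 7, offset in 8, width of the cell in 9).\<close>

definition get_letter :: "aexp \<Rightarrow> com" where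
  "get_letter a =
     Seq (Assign 8 a) (Seq (Assign 7 (Num 0)) (Seq load_width
     (Seq (While (Neg (Less (Reg 8) (Reg 9)))
       (Seq (Assign 8 (Sub (Reg 8) (Reg 9))) (Seq (Assign 7 (Add (Reg 7) (Num 1))) load_width)))
     (Cond (IsRun (Reg 7)) (Assign 6 (Sub (Reg 0) (Num 1))) (Assign 6 (CellVal (Reg 7)))))))"

lemma wp_load_width:
  assumes "regs s 7 < length (cells s)"
  shows "wp load_width Q s \<longleftrightarrow>
    Q (s\<lparr>regs := (regs s)(9 := length (expand q (cells s ! regs s 7)))\<rparr>)"
  using assms by (cases "cells s ! regs s 7") (auto simp: load_width_def)

lemma wp_get_letter:
  assumes cells: "cells s = compress q w" and q: "regs s 0 = q" and a: "aval a s < length w"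
    and Q: "\<And>t. same_store s t \<Longrightarrow> \<forall>r. r \<notin> {6..9} \<longrightarrow> regs t r = regs s r \<Longrightarrow>
      regs t 6 = w ! aval a s \<Longrightarrow> Q t"
  shows "wp (get_letter a) Q s"
proof -
  define cs where "cs = compress q w"
  \<comment> \<open>Invariant: the sought letter is at offset register 8 of the word spelled by the
    cells from register 7 on.\<close>
  define I where "I t \<longleftrightarrow> same_store s t \<and> (\<forall>r. r \<notin> {6..9} \<longrightarrow> regs t r = regs s r) \<and>
    regs t 7 < length cs \<and> regs t 9 = length (expand q (cs ! regs t 7)) \<and>
    regs t 8 < length (decompress q (drop (regs t 7) cs)) \<and>
    decompress q (drop (regs t 7) cs) ! regs t 8 = w ! aval a s" for t
  have dec: "decompress q cs = w" by (simp add: cs_def)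
  have ne: "0 < length cs" using a by (auto simp: cs_def)
  have drop: "drop p cs = cs ! p # drop (Suc p) cs" if "p < length cs" for p
    using that by (simp add: Cons_nth_drop_Suc)
  let ?b = "Neg (Less (Reg 8) (Reg 9))"
  let ?c = "Seq (Assign 8 (Sub (Reg 8) (Reg 9))) (Seq (Assign 7 (Add (Reg 7) (Num 1))) load_width)"
  let ?d = "Cond (IsRun (Reg 7)) (Assign 6 (Sub (Reg 0) (Num 1))) (Assign 6 (CellVal (Reg 7)))"
  have loop: "wp (While ?b ?c) (wp ?d Q) t" if "I t" for t
    using that
  proof (rule wp_While[where I = I and f = "\<lambda>t. length cs - regs t 7"])
    fix t assume I: "I t" and b: "bval ?b t"
    have c: "cells t = cs" using I cells by (simp add: I_def same_store_def cs_def)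
    have "regs t 8 - regs t 9 < length (decompress q (drop (Suc (regs t 7)) cs)) \<and>
      decompress q (drop (Suc (regs t 7)) cs) ! (regs t 8 - regs t 9) = w ! aval a s"
      using I b drop[of "regs t 7"] by (auto simp: I_def nth_append)
    moreover from this have "Suc (regs t 7) < length cs"
      by (metis decompress_simps(1) drop_all length_0_conv less_nat_zero_code not_less)
    ultimately show "wp ?c (\<lambda>t'. I t' \<and> length cs - regs t' 7 < length cs - regs t 7) t"
      using I c by (auto simp: wp_load_width[where q = q] I_def same_store_def)
  next
    fix t assume I: "I t" and b: "\<not> bval ?b t"
    have c: "cells t = cs" using I cells by (simp add: I_def same_store_def cs_def)
    have p: "regs t 7 < length cs" using I by (simp add: I_def)
    have "expand q (cs ! regs t 7) ! regs t 8 = w ! aval a s"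
      "regs t 8 < length (expand q (cs ! regs t 7))"
      using I b drop[of "regs t 7"] by (auto simp: I_def nth_append)
    moreover have "regs t 0 = q" using I q by (auto simp: I_def)
    ultimately show "wp ?d Q t" using I c p
      by (cases "cs ! regs t 7") (auto intro!: Q simp: I_def same_store_def)
  qed
  have "wp load_width (wp (While ?b ?c) (wp ?d Q)) (s\<lparr>regs := (regs s)(8 := aval a s, 7 := 0)\<rparr>)"
    using ne cells
    by (subst wp_load_width[where q = q], simp add: cs_def, intro loop)
      (use a dec in \<open>simp add: I_def same_store_def cs_def\<close>)
  then show ?thesis by (simp add: get_letter_def)
qed

section \<open>Changing the end of the word\<close>

definition last_cell :: aexp where
  "last_cell = Sub NumCells (Num 1)"

text \<open>Each branch costs one update. On the empty list \<open>last_cell\<close> is 0 by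
  truncated subtraction and \<open>IsRun\<close> is false, so a cell is inserted.\<close>

definition append_letter :: com where
  "append_letter = Cond (Less (Reg 6) (Sub (Reg 0) (Num 1)))
     (Insert NumCells (SymC (Reg 6)))
     (Cond (IsRun last_cell)
       (Modify last_cell (RunC (Add (CellVal last_cell) (Num 1))))
       (Insert NumCells (RunC (Num 1))))"

lemma aval_last_cell [simp]: "aval last_cell s = length (cells s) - 1"
  by (simp add: last_cell_def)

lemma wp_append_letter:
  assumes "cells s = compress q u" "regs s 0 = q" "regs s 6 \<le> q - 1"
  shows "wp append_letter Q s \<longleftrightarrow>
    Q (s\<lparr>cells := compress q (u @ [regs s 6]), updates := Suc (updates s)\<rparr>)"
proof (cases "regs s 6 = q - 1")
  case False
  then show ?thesis using assms by (simp add: append_letter_def compress_snoc_sym)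
next
  case True
  have "bval (IsRun last_cell) s \<longleftrightarrow> u \<noteq> [] \<and> last u = q - 1"
    using assms(1) compress_last_run[of u q] by (cases "u = []") (auto simp: last_conv_nth)
  moreover have "last (compress q u) = compress q u ! (length (compress q u) - 1)" if "u \<noteq> []"
    using that by (simp add: last_conv_nth)
  ultimately show ?thesis using True assms
    using compress_snoc_max[of q u] by (simp add: append_letter_def del: bval.simps(4))
qed

text \<open>As runs are maximal, a letter that becomes \<open>q - 1\<close> has to join a run in
  front of it: its cell is deleted and \<open>append_letter\<close> enlarges that run. With the
  deletion of the trailing run this makes at most three updates.\<close>

definition increment_last :: com where
  "increment_last =
     Seq (Cond (IsRun last_cell)
       (Seq (Assign 2 (Sub (Reg 2) (CellVal last_cell))) (Delete last_cell)) Skip)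
     (Seq (Assign 6 (Add (CellVal last_cell) (Num 1)))
     (Cond (Less (Reg 6) (Sub (Reg 0) (Num 1))) (Modify last_cell (SymC (Reg 6)))
     (Cond (IsRun (Sub NumCells (Num 2))) (Seq (Delete last_cell) append_letter)
       (Modify last_cell (RunC (Num 1))))))"

lemma wp_increment_last:
  assumes cells: "cells s = compress q (y @ [a] @ replicate r (q - 1))"
    and regs: "regs s 0 = q" "regs s 2 = length y + 1 + r" and a: "a < q - 1"
    and Q: "\<And>t. cells t = compress q (y @ [Suc a]) \<Longrightarrow> emitted t = emitted s \<Longrightarrow>
      regs t 0 = q \<Longrightarrow> regs t 1 = regs s 1 \<Longrightarrow> regs t 2 = Suc (length y) \<Longrightarrow>
      updates t = updates s + (if r = 0 then 0 else 1) + 1 +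
        (if y \<noteq> [] \<and> last y = q - 1 \<and> Suc a = q - 1 then 1 else 0) \<Longrightarrow> Q t"
  shows "wp increment_last Q s"
proof -
  let ?c = "Seq (Assign 6 (Add (CellVal last_cell) (Num 1)))
     (Cond (Less (Reg 6) (Sub (Reg 0) (Num 1))) (Modify last_cell (SymC (Reg 6)))
     (Cond (IsRun (Sub NumCells (Num 2))) (Seq (Delete last_cell) append_letter)
       (Modify last_cell (RunC (Num 1)))))"
  have ya: "compress q (y @ [a]) = compress q y @ [Sym a]"
    using a by (intro compress_snoc_sym) simp
  have inc: "wp ?c Q t"
    if t: "cells t = compress q (y @ [a])" "regs t 0 = q" "regs t 1 = regs s 1"
      "regs t 2 = Suc (length y)" "emitted t = emitted s"
      "updates t = updates s + (if r = 0 then 0 else 1)" for t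
  proof (cases "Suc a = q - 1")
    case False
    then show ?thesis using t a by (auto intro!: Q simp: ya compress_snoc_sym)
  next
    case True
    \<comment> \<open>With a single cell the truncated index is that of the last cell itself, which
      is a symbol, so the test correctly fails.\<close>
    have run: "(length (cells t) - 2 < length (cells t) \<and>
        (\<exists>i. cells t ! (length (cells t) - 2) = Run i)) \<longleftrightarrow> y \<noteq> [] \<and> last y = q - 1"
    proof (cases "y = []")
      case False
      then have "(compress q y @ [Sym a]) ! (length (compress q y) - Suc 0) = last (compress q y)"
        by (simp add: nth_append last_conv_nth)
      then show ?thesis using False t(1) compress_last_run[of y q] by (auto simp: ya)
    next
      case True
      then show ?thesis using t(1) a by auto
    qed
    show ?thesis
    proof (cases "y \<noteq> [] \<and> last y = q - 1")
      case yes: True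
      with run have "bval (IsRun (Sub NumCells (Num 2))) t" by simp
      then show ?thesis using t True yes
        by (auto intro!: Q simp: ya wp_append_letter[where q = q and u = y] nth_append)
    next
      case no: False
      with run show ?thesis using t True compress_snoc_max[of q y]
        by (auto intro!: Q simp: ya nth_append simp del: One_nat_def)
    qed
  qed
  show ?thesis
  proof (cases r)
    case 0
    then show ?thesis using inc[of s] cells regs
      by (simp add: increment_last_def ya)
  next
    case (Suc r')
    have "cells s = compress q (y @ [a]) @ [Run r]"
      using cells a compress_snoc_run[of a q y r'] Suc by simp
    then show ?thesis using regs Suc inc[of "s\<lparr>regs := (regs s)(2 := Suc (length y)),
        cells := compress q (y @ [a]), updates := Suc (updates s)\<rparr>"]
      by (simp add: increment_last_def)
  qed
qed

text \<open>Puts into register 5 the last position below \<open>n\<close> at which the periodic word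
  \<open>w w w \<dots>\<close> has a letter below \<open>q - 1\<close>; register 4 is register 3 modulo the length of \<open>w\<close>.\<close>

definition find_cut :: com where
  "find_cut =
     Seq (Assign 3 (Reg 2)) (Seq (Assign 4 (Num 0)) (Seq (Assign 5 (Reg 2))
     (While (Less (Reg 3) (Reg 1))
       (Seq (get_letter (Reg 4))
       (Seq (Cond (Less (Reg 6) (Sub (Reg 0) (Num 1))) (Assign 5 (Reg 3)) Skip)
       (Seq (Assign 3 (Add (Reg 3) (Num 1)))
       (Seq (Assign 4 (Add (Reg 4) (Num 1)))
       (Cond (Less (Reg 4) (Reg 2)) Skip (Assign 4 (Num 0))))))))))"

text \<open>Position \<open>length w\<close> repeats \<open>w ! 0 < q - 1\<close> and is a valid
  first candidate. Hence the cut lies beyond \<open>w\<close>, and the successor arises by appending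
  alone.\<close>

lemma wp_find_cut:
  assumes cells: "cells s = compress q w"
    and regs: "regs s 0 = q" "regs s 1 = n" "regs s 2 = length w"
    and w: "w \<noteq> []" "length w < n" "w ! 0 < q - 1" "set w \<subseteq> {..<q}"
    and Q: "\<And>t l. same_store s t \<Longrightarrow> regs t 0 = q \<Longrightarrow> regs t 1 = n \<Longrightarrow>
      regs t 2 = length w \<Longrightarrow> regs t 5 = l \<Longrightarrow> length w \<le> l \<Longrightarrow> l < n \<Longrightarrow>
      w ! (l mod length w) < q - 1 \<Longrightarrow>
      (\<And>j. l < j \<Longrightarrow> j < n \<Longrightarrow> w ! (j mod length w) = q - 1) \<Longrightarrow> Q t"
  shows "wp find_cut Q s"
proof -
  define m where "m = length w"
  define x where "x j = w ! (j mod m)" for j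
  have "m > 0" using w(1) by (simp add: m_def)
  have x: "x j \<le> q - 1" for j
  proof -
    have "x j \<in> set w" using \<open>m > 0\<close> by (simp add: x_def m_def)
    then show ?thesis using w(4) by fastforce
  qed
  define I where "I t \<longleftrightarrow> m \<le> regs t 3 \<and> same_store s t \<and> regs t 0 = q \<and> regs t 1 = n \<and> regs t 2 = m \<and>
    m \<le> regs t 5 \<and> regs t 5 < n \<and> regs t 4 = regs t 3 mod m \<and> x (regs t 5) < q - 1 \<and>
    (\<forall>j. regs t 5 < j \<and> j < regs t 3 \<longrightarrow> x j = q - 1)" for t :: state
  let ?b = "Less (Reg 3) (Reg 1)"
  let ?d = "Seq (Cond (Less (Reg 6) (Sub (Reg 0) (Num 1))) (Assign 5 (Reg 3)) Skip)
       (Seq (Assign 3 (Add (Reg 3) (Num 1)))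
       (Seq (Assign 4 (Add (Reg 4) (Num 1)))
       (Cond (Less (Reg 4) (Reg 2)) Skip (Assign 4 (Num 0)))))"
  let ?c = "Seq (get_letter (Reg 4)) ?d"
  have loop: "wp (While ?b ?c) Q t" if "I t" for t
    using that
  proof (rule wp_While[where I = I and f = "\<lambda>t. n - regs t 3"])
    fix t assume I: "I t" and b: "bval ?b t"
    show "wp ?c (\<lambda>t'. I t' \<and> n - regs t' 3 < n - regs t 3) t"
      unfolding wp_Seq[of "get_letter (Reg 4)"]
    proof (rule wp_get_letter[where q = q and w = w])
      show "cells t = compress q w" "regs t 0 = q" using I cells
        by (simp_all add: I_def same_store_def)
      show "aval (Reg 4) t < length w" using I \<open>m > 0\<close> by (simp add: I_def m_def)
    next
      fix u assume u: "same_store t u" "\<forall>r. r \<notin> {6..9} \<longrightarrow> regs u r = regs t r"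
        "regs u 6 = w ! aval (Reg 4) t"
      have r: "regs u 0 = q" "regs u 1 = n" "regs u 2 = m" "regs u 3 = regs t 3"
        "regs u 4 = regs t 3 mod m" "regs u 5 = regs t 5" "regs u 6 = x (regs t 3)"
        using u(2,3) I by (simp_all add: I_def x_def)
      \<comment> \<open>\<open>aexp\<close> has no remainder operation; register 4 follows
        \<open>regs t 3 mod m\<close> by being reset to 0.\<close>
      have md: "Suc (regs t 3) mod m =
          (if Suc (regs t 3 mod m) < m then Suc (regs t 3 mod m) else 0)"
        using \<open>m > 0\<close> mod_less_divisor[OF \<open>m > 0\<close>, of "regs t 3"] by (auto simp: mod_Suc)
      have "same_store s u" using u(1) I by (simp add: I_def same_store_def)
      then show "wp ?d (\<lambda>t'. I t' \<and> n - regs t' 3 < n - regs t 3) u"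
        using I b r x[of "regs t 3"]
        by (cases "x (regs t 3) < q - 1") (simp_all add: I_def same_store_def md less_Suc_eq, auto)
    qed
  next
    fix t assume "I t" "\<not> bval ?b t"
    then show "Q t" by (intro Q[where l = "regs t 5"]) (auto simp: I_def m_def x_def)
  qed
  have "I (s\<lparr>regs := (regs s)(3 := m, 4 := 0, 5 := m)\<rparr>)"
    using regs w by (simp add: I_def same_store_def m_def x_def)
  from loop[OF this] show ?thesis using regs(3) by (simp add: find_cut_def m_def)
qed

text \<open>The next letter of the periodic word stands \<open>length w\<close> places back in the
  word under construction, so no remainder has to be computed.\<close>

definition extend :: com where
  "extend =
     Seq (Assign 3 (Reg 2))
     (Seq (While (Less (Reg 3) (Reg 5))
       (Seq (get_letter (Sub (Reg 3) (Reg 2))) (Seq append_letter (Assign 3 (Add (Reg 3) (Num 1))))))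
     (Seq (get_letter (Sub (Reg 3) (Reg 2)))
     (Seq (Assign 6 (Add (Reg 6) (Num 1)))
     (Seq append_letter (Assign 2 (Add (Reg 3) (Num 1)))))))"

lemma wp_extend:
  assumes cells: "cells s = compress q w"
    and regs: "regs s 0 = q" "regs s 1 = n" "regs s 2 = length w" "regs s 5 = l"
    and w: "w \<noteq> []" "length w \<le> l" "set w \<subseteq> {..<q}" "w ! (l mod length w) < q - 1"
    and Q: "\<And>t. cells t = compress q (duval_next w l) \<Longrightarrow> emitted t = emitted s \<Longrightarrow>
      regs t 0 = q \<Longrightarrow> regs t 1 = n \<Longrightarrow> regs t 2 = Suc l \<Longrightarrow>
      updates t = updates s + (Suc l - length w) \<Longrightarrow> Q t"
  shows "wp extend Q s"
proof -
  define m where "m = length w"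
  define x where "x j = w ! (j mod m)" for j
  define u where "u j = map x [0..<j]" for j
  have "m > 0" using w(1) by (simp add: m_def)
  have x: "x j \<le> q - 1" for j
  proof -
    have "x j \<in> set w" using \<open>m > 0\<close> by (simp add: x_def m_def)
    then show ?thesis using w(3) by fastforce
  qed
  have u_Suc: "u (Suc j) = u j @ [x j]" for j by (simp add: u_def)
  have u_nth: "u j ! (j - m) = x j" if "m \<le> j" for j
    using that \<open>m > 0\<close> by (simp add: u_def x_def le_mod_geq)
  have u_len: "j - m < length (u j)" if "m \<le> j" for j
    using that \<open>m > 0\<close> by (simp add: u_def)
  have um: "u m = w" by (rule nth_equalityI) (simp_all add: u_def x_def m_def)
  define I where "I t \<longleftrightarrow> cells t = compress q (u (regs t 3)) \<and> emitted t = emitted s \<and>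
    regs t 0 = q \<and> regs t 1 = n \<and> regs t 2 = m \<and> regs t 5 = l \<and> m \<le> regs t 3 \<and>
    regs t 3 \<le> l \<and> updates t = updates s + (regs t 3 - m)" for t :: state
  let ?g = "get_letter (Sub (Reg 3) (Reg 2))"
  let ?b = "Less (Reg 3) (Reg 5)"
  let ?d = "Seq append_letter (Assign 3 (Add (Reg 3) (Num 1)))"
  let ?e = "Seq (Assign 6 (Add (Reg 6) (Num 1)))
     (Seq append_letter (Assign 2 (Add (Reg 3) (Num 1))))"
  have get: "wp ?g R t" if I: "I t"
    and R: "\<And>t'. I t' \<Longrightarrow> regs t' 3 = regs t 3 \<Longrightarrow> regs t' 6 = x (regs t 3) \<Longrightarrow> R t'" for t R
  proof (rule wp_get_letter[where q = q and w = "u (regs t 3)"])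
    show "cells t = compress q (u (regs t 3))" "regs t 0 = q"
      "aval (Sub (Reg 3) (Reg 2)) t < length (u (regs t 3))"
      using I u_len by (simp_all add: I_def)
  next
    fix t' assume t': "same_store t t'" "\<forall>r. r \<notin> {6..9} \<longrightarrow> regs t' r = regs t r"
      "regs t' 6 = u (regs t 3) ! aval (Sub (Reg 3) (Reg 2)) t"
    then show "R t'" using I u_nth by (intro R) (auto simp: I_def same_store_def)
  qed
  have loop: "wp (While ?b (Seq ?g ?d)) (wp ?g (wp ?e Q)) t" if "I t" for t
    using that
  proof (rule wp_While[where I = I and f = "\<lambda>t. l - regs t 3"])
    fix t assume I: "I t" and b: "bval ?b t"
    show "wp (Seq ?g ?d) (\<lambda>t'. I t' \<and> l - regs t' 3 < l - regs t 3) t"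
      unfolding wp_Seq[of ?g]
    proof (rule get[OF I])
      fix t' assume t': "I t'" "regs t' 3 = regs t 3" "regs t' 6 = x (regs t 3)"
      then show "wp ?d (\<lambda>t'. I t' \<and> l - regs t' 3 < l - regs t 3) t'"
        using b I x[of "regs t 3"]
        by (simp add: I_def wp_append_letter[where q = q and u = "u (regs t 3)"] u_Suc, auto)
    qed
  next
    fix t assume I: "I t" and b: "\<not> bval ?b t"
    show "wp ?g (wp ?e Q) t"
    proof (rule get[OF I])
      fix t' assume t': "I t'" "regs t' 3 = regs t 3" "regs t' 6 = x (regs t 3)"
      have l: "regs t 3 = l" using I b by (simp add: I_def)
      have "duval_next w l = u l @ [Suc (x l)]"
        by (simp add: duval_next_def u_def x_def[abs_def] m_def)
      moreover have "x l < q - 1" using w(4) by (simp add: x_def m_def)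
      ultimately show "wp ?e Q t'" using t' l w(2)
        by (simp add: I_def wp_append_letter[where q = q and u = "u l"]) (rule Q, auto simp: m_def)
    qed
  qed
  have "I (s\<lparr>regs := (regs s)(3 := m)\<rparr>)"
    using regs cells w(2) by (simp add: I_def m_def[symmetric] um)
  from loop[OF this] show ?thesis using regs(3) by (simp add: extend_def m_def)
qed

subsection \<open>Amortized analysis\<close>

text \<open>The empty word is excluded because it satisfies \<open>lyndon\<close> vacuously.\<close>

definition lyndon_upto :: "nat \<Rightarrow> nat \<Rightarrow> nat list set" where
  "lyndon_upto q n = {w. w \<noteq> [] \<and> length w \<le> n \<and> set w \<subseteq> {..<q} \<and> lyndon w}"

lemma finite_lyndon_words: "finite (lyndon_words q k)"
  by (rule finite_subset[OF _ finite_lists_length_eq[of "{..<q}" k]]) (auto simp: lyndon_words_def)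

lemma lyndon_upto_eq: "lyndon_upto q n = (\<Union>k\<in>{1..n}. lyndon_words q k)"
  by (auto simp: lyndon_upto_def lyndon_words_def Suc_le_eq)

lemma finite_lyndon_upto: "finite (lyndon_upto q n)"
  by (simp add: lyndon_upto_eq finite_lyndon_words)

lemma lyndon_words_eq_upto:
  "n \<ge> 1 \<Longrightarrow> lyndon_words q n = {w \<in> lyndon_upto q n. length w = n}"
  by (auto simp: lyndon_upto_def lyndon_words_def)

text \<open>A word of length k is counted in L_k, ..., L_n, that is n - k + 1 times; one count per
  word is split off as L_n.\<close>

lemma sumsum_lyndon_eq:
  "sumsum_lyndon q n = sum_lyndon q n + (\<Sum>k=1..n. (n - k) * num_lyndon q k)"
proof (induction n)
  case (Suc n)
  have "(\<Sum>k=1..Suc n. (Suc n - k) * num_lyndon q k)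
      = (\<Sum>k=1..n. (n - k) * num_lyndon q k + num_lyndon q k)"
    by (simp add: Suc_diff_le add.commute)
  also have "\<dots> = (\<Sum>k=1..n. (n - k) * num_lyndon q k) + sum_lyndon q n"
    by (simp add: sum.distrib sum_lyndon_def)
  finally show ?case using Suc by (simp add: sumsum_lyndon_def)
qed (simp add: sumsum_lyndon_def sum_lyndon_def)

definition budget :: "nat \<Rightarrow> nat list \<Rightarrow> nat" where
  "budget n v = 3 * (n - length v) + (if length v = n then 1 else 0)"

text \<open>The total budget is the numerator of the bound, with L_n moved to the left to avoid
  truncated subtraction.\<close>

lemma sum_budget:
  assumes "n \<ge> 1"
  shows "(\<Sum>v\<in>lyndon_upto q n. budget n v) + 3 * sum_lyndon q n
     = 3 * sumsum_lyndon q n + num_lyndon q n"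
proof -
  have "(\<Sum>v\<in>lyndon_upto q n. budget n v) = (\<Sum>k=1..n. \<Sum>v\<in>lyndon_words q k. budget n v)"
    unfolding lyndon_upto_eq
    by (rule sum.UNION_disjoint) (auto simp: finite_lyndon_words, auto simp: lyndon_words_def)
  also have "\<dots> = (\<Sum>k=1..n. 3 * ((n - k) * num_lyndon q k) + (if k = n then num_lyndon q k else 0))"
  proof (rule sum.cong)
    fix k
    have "(\<Sum>v\<in>lyndon_words q k. budget n v)
        = (\<Sum>v\<in>lyndon_words q k. 3 * (n - k) + (if k = n then 1 else 0))"
      by (rule sum.cong) (auto simp: budget_def lyndon_words_def)
    then show "(\<Sum>v\<in>lyndon_words q k. budget n v)
        = 3 * ((n - k) * num_lyndon q k) + (if k = n then num_lyndon q k else 0)"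
      by (simp add: num_lyndon_def algebra_simps)
  qed simp
  also have "\<dots> = 3 * (\<Sum>k=1..n. (n - k) * num_lyndon q k) + num_lyndon q n"
    using assms by (simp add: sum.distrib sum_distrib_left)
  finally show ?thesis by (simp add: sumsum_lyndon_eq)
qed

section \<open>Progress through the order and the account of updates\<close>

definition below :: "nat \<Rightarrow> nat \<Rightarrow> nat list \<Rightarrow> nat list set" where
  "below q n w = {v \<in> lyndon_upto q n. lex_less v w}"

lemma finite_below: "finite (below q n w)"
  by (simp add: below_def finite_lyndon_upto)

text \<open>By \<open>duval_next_le\<close> no word lies strictly between \<open>w\<close> and its
  successor.\<close>

lemma duval_next_step:
  assumes w: "w \<in> lyndon_upto q n" and l: "l < n" "w ! (l mod length w) < q - 1"
    and tail: "\<And>j. l < j \<Longrightarrow> j < n \<Longrightarrow> w ! (j mod length w) = q - 1"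
  shows "duval_next w l \<in> lyndon_upto q n"
    and "below q n (duval_next w l) = insert w (below q n w)" and "w \<notin> below q n w"
proof -
  have w': "lyndon w" "w \<noteq> []" "length w \<le> n" "set w \<subseteq> {..<q}"
    using w by (auto simp: lyndon_upto_def)
  show "duval_next w l \<in> lyndon_upto q n"
    using lyndon_duval_next[OF w'(1,2), of l] set_duval_next[OF w'(2,4) l(2)] l(1)
    by (auto simp: lyndon_upto_def duval_next_def)
  have "lex_less v w" if v: "v \<in> lyndon_upto q n" "lex_less v (duval_next w l)" "v \<noteq> w" for v
  proof (rule ccontr)
    assume "\<not> lex_less v w"
    with v(3) have "lex_less w v" using lex_less_total by blast
    then have "v = duval_next w l \<or> lex_less (duval_next w l) v"
      using duval_next_le[OF w'(1,2) _ _ _ _ tail, of v] v(1) by (auto simp: lyndon_upto_def)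
    then show False using v(2) lex_less_asym lex_less_irrefl by blast
  qed
  then show "below q n (duval_next w l) = insert w (below q n w)"
    using lex_less_duval_next[OF w'(2), of l] lex_less_trans w by (auto simp: below_def)
  show "w \<notin> below q n w" using lex_less_irrefl by (auto simp: below_def)
qed

lemma below_first: "below q n [0] = {}"
proof -
  have "\<not> lex_less v [0]" if "v \<noteq> []" for v
    using that by (auto simp: lex_less_nth)
  then show ?thesis by (auto simp: below_def lyndon_upto_def)
qed

lemma below_last:
  "below q n [q - 1] = lyndon_upto q n - {[q - 1]}"
proof -
  have "lex_less v [q - 1]" if v: "v \<in> lyndon_upto q n" "v \<noteq> [q - 1]" for v
  proof -
    have v': "lyndon v" "v \<noteq> []" "set v \<subseteq> {..<q}" using v(1) by (auto simp: lyndon_upto_def)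
    then have "v ! 0 \<noteq> q - 1" using lyndon_max_hd v(2) by blast
    moreover have "v ! 0 < q" using v'(2,3) by (meson length_greater_0_conv lessThan_iff nth_mem subsetD)
    ultimately have "v ! 0 < q - 1" by simp
    then show ?thesis using v'(2) by (auto simp: lex_less_nth)
  qed
  then show ?thesis using lex_less_irrefl by (auto simp: below_def)
qed

text \<open>Updates in excess of the budget of the earlier words that may be outstanding when \<open>w\<close>
  is reached: reaching a word of length below \<open>n\<close> deletes a run, increments a letter and may
  merge the result with a run, and a word of length \<open>n\<close> reached by a merge ends with two
  letters \<open>q - 1\<close> and can pass its debt on.\<close>

definition debt :: "nat \<Rightarrow> nat \<Rightarrow> nat list \<Rightarrow> nat" where
  "debt q n w =
     (if length w < n then (if length w + 1 = n then 2 else 3)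
      else if (\<exists>u. w = u @ [q - 1, q - 1]) then 1 else 0)"

text \<open>With d = n - |w|: 1 + 2 = 3 for d = 1, and d + 3 <= 3 d for d >= 2. A short word thus
  pays for its extension and all debt.\<close>

lemma debt_short: "length w < n \<Longrightarrow> (n - length w) + debt q n w \<le> budget n w"
  by (auto simp: debt_def budget_def)

text \<open>The \<open>Suc\<close> is the update that writes the first letter. The word
  \<open>w\<close> has been reached but not yet emitted.\<close>

definition lyndon_inv :: "nat \<Rightarrow> nat \<Rightarrow> state \<Rightarrow> bool" where
  "lyndon_inv q n s \<longleftrightarrow> (\<exists>w ws. w \<in> lyndon_upto q n \<and> cells s = compress q w \<and>
     regs s 0 = q \<and> regs s 1 = n \<and> regs s 2 = length w \<and>
     sorted_wrt lex_less ws \<and> set ws = {v \<in> below q n w. length v = n} \<and>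
     emitted s = map (compress q) ws \<and>
     updates s \<le> Suc (debt q n w + (\<Sum>v\<in>below q n w. budget n v)))"

definition lyndon_step :: com where
  "lyndon_step = Cond (Less (Reg 2) (Reg 1)) (Seq find_cut extend) (Seq Emit increment_last)"

lemma ex_last_letter:
  fixes w :: "nat list"
  assumes "w ! 0 < q - 1" "w \<noteq> []" "set w \<subseteq> {..<q}"
  obtains y a r where "w = y @ [a] @ replicate r (q - 1)" "a < q - 1"
proof -
  have "\<exists>x\<in>set w. x < q - 1" using assms(1,2) by (metis length_greater_0_conv nth_mem)
  then obtain y a z where w: "w = y @ a # z" "a < q - 1" "\<forall>x\<in>set z. \<not> x < q - 1"
    using split_list_last_prop[of w "\<lambda>x. x < q - 1"] by blast
  have "\<forall>x\<in>set z. x = q - 1" using w(1,3) assms(3) by fastforce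
  then have "replicate (length z) (q - 1) = z" by (rule replicate_length_same)
  with w that show ?thesis by (metis append_Cons append_Nil)
qed

lemma wp_lyndon_step:
  assumes inv: "lyndon_inv q n s" and run: "\<not> bval (IsRun (Num 0)) s"
  shows "wp lyndon_step (\<lambda>t. lyndon_inv q n t \<and>
    card (lyndon_upto q n - below q n (decompress q (cells t)))
      < card (lyndon_upto q n - below q n (decompress q (cells s)))) s"
proof -
  obtain w ws where w: "w \<in> lyndon_upto q n" and cells: "cells s = compress q w"
    and regs: "regs s 0 = q" "regs s 1 = n" "regs s 2 = length w"
    and ws: "sorted_wrt lex_less ws" "set ws = {v \<in> below q n w. length v = n}"
    and emit: "emitted s = map (compress q) ws"
    and upd: "updates s \<le> Suc (debt q n w + (\<Sum>v\<in>below q n w. budget n v))"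
    using inv unfolding lyndon_inv_def by blast
  have w': "lyndon w" "w \<noteq> []" "length w \<le> n" "set w \<subseteq> {..<q}"
    using w by (auto simp: lyndon_upto_def)
  have "w ! 0 \<noteq> q - 1" using run cells w'(2) compress_hd_run[of w q] by auto
  moreover have "w ! 0 < q" using w'(2,4) by (meson length_greater_0_conv lessThan_iff nth_mem subsetD)
  ultimately have w0: "w ! 0 < q - 1" by simp
  let ?Q = "\<lambda>t. lyndon_inv q n t \<and>
    card (lyndon_upto q n - below q n (decompress q (cells t)))
      < card (lyndon_upto q n - below q n (decompress q (cells s)))"
  \<comment> \<open>Reduces both branches to one inequality: the cost of the step and the debt at
    \<open>w\<close> are covered by the budget of \<open>w\<close> and the debt at the
    successor.\<close>
  have post: "?Q t"
    if l: "l < n" "w ! (l mod length w) < q - 1"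
      "\<And>j. l < j \<Longrightarrow> j < n \<Longrightarrow> w ! (j mod length w) = q - 1"
      and t: "cells t = compress q (duval_next w l)" "regs t 0 = q" "regs t 1 = n"
        "regs t 2 = Suc l"
        "emitted t = emitted s @ (if length w = n then [compress q w] else [])"
        "updates t + debt q n w \<le> updates s + debt q n (duval_next w l) + budget n w" for t l
  proof
    note step = duval_next_step[OF w l, simplified]
    define ws' where "ws' = ws @ (if length w = n then [w] else [])"
    have "sorted_wrt lex_less ws'" using ws by (auto simp: ws'_def sorted_wrt_append below_def)
    moreover have "set ws' = {v \<in> below q n (duval_next w l). length v = n}"
      using ws(2) by (auto simp: ws'_def step(2))
    moreover have "emitted t = map (compress q) ws'" using emit t(5) by (simp add: ws'_def)
    moreover have "(\<Sum>v\<in>below q n (duval_next w l). budget n v)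
        = budget n w + (\<Sum>v\<in>below q n w. budget n v)"
      unfolding step(2) using step(3) by (simp add: finite_below)
    ultimately show "lyndon_inv q n t" unfolding lyndon_inv_def using t step(1) upd
      by (intro exI[of _ "duval_next w l"] exI[of _ ws']) simp
    have "lyndon_upto q n - below q n (duval_next w l) \<subset> lyndon_upto q n - below q n w"
      unfolding step(2) using step(3) w by auto
    then show "card (lyndon_upto q n - below q n (decompress q (cells t)))
      < card (lyndon_upto q n - below q n (decompress q (cells s)))"
      unfolding t(1) cells decompress_compress by (intro psubset_card_mono) (simp add: finite_lyndon_upto)
  qed
  show ?thesis
  proof (cases "length w < n")
    case True
    have "wp find_cut (wp extend ?Q) s"
    proof (rule wp_find_cut[OF cells regs w'(2) True w0 w'(4)])
      fix t l assume t: "same_store s t" "regs t 0 = q" "regs t 1 = n" "regs t 2 = length w"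
        "regs t 5 = l" and l: "length w \<le> l" "l < n" "w ! (l mod length w) < q - 1"
        "\<And>j. l < j \<Longrightarrow> j < n \<Longrightarrow> w ! (j mod length w) = q - 1"
      have "cells t = compress q w" using t(1) cells by (simp add: same_store_def)
      then show "wp extend ?Q t"
      proof (rule wp_extend[OF _ t(2-5) w'(2) l(1) w'(4) l(3)])
        fix t' :: state assume t': "cells t' = compress q (duval_next w l)" "emitted t' = emitted t"
          "regs t' 0 = q" "regs t' 1 = n" "regs t' 2 = Suc l"
          "updates t' = updates t + (Suc l - length w)"
        \<comment> \<open>At most n - |w| letters are appended, so \<open>debt_short\<close> covers
          everything from the budget of \<open>w\<close>.\<close>
        have "updates t' + debt q n w \<le> updates s + budget n w"
          using t'(6) t(1) debt_short[OF True, of q] l(2) by (simp add: same_store_def)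
        then show "?Q t'" using t' t(1) l True by (intro post) (auto simp: same_store_def)
      qed
    qed
    then show ?thesis using True regs by (simp add: lyndon_step_def)
  next
    case False
    then have len: "length w = n" using w'(3) by simp
    \<comment> \<open>For |w| = n the cut lies inside \<open>w\<close>, at position
      \<open>length y\<close>, and there is no periodic continuation.\<close>
    obtain y a r where w_eq: "w = y @ [a] @ replicate r (q - 1)" and a: "a < q - 1"
      using ex_last_letter[OF w0 w'(2,4)] .
    have next_eq: "duval_next w (length y) = y @ [Suc a]"
    proof -
      have "map (\<lambda>j. w ! (j mod length w)) [0..<length y] = y"
        by (rule nth_equalityI) (auto simp: w_eq nth_append)
      then show ?thesis by (simp add: duval_next_def w_eq nth_append)
    qed
    have n: "n = length y + 1 + r" using len by (simp add: w_eq)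
    have "wp increment_last ?Q (s\<lparr>emitted := emitted s @ [cells s]\<rparr>)"
    proof (rule wp_increment_last[where q = q and y = y and a = a and r = r])
      fix t :: state assume t: "cells t = compress q (y @ [Suc a])"
        "emitted t = emitted (s\<lparr>emitted := emitted s @ [cells s]\<rparr>)" "regs t 0 = q"
        "regs t 1 = regs (s\<lparr>emitted := emitted s @ [cells s]\<rparr>) 1" "regs t 2 = Suc (length y)"
        "updates t = updates (s\<lparr>emitted := emitted s @ [cells s]\<rparr>) + (if r = 0 then 0 else 1) + 1 +
          (if y \<noteq> [] \<and> last y = q - 1 \<and> Suc a = q - 1 then 1 else 0)"
      have "updates t + debt q n w \<le> updates s + debt q n (y @ [Suc a]) + budget n w"
      proof (cases "r = 0")
        \<comment> \<open>The budget 1 pays for the increment; a merge costs one more, which becomes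
          the debt of a new word ending in two letters \<open>q - 1\<close>.\<close>
        case True
        then have "debt q n w = 0" using len a by (auto simp: debt_def w_eq)
        moreover have "debt q n (y @ [Suc a]) = 1"
          if m: "y \<noteq> []" "last y = q - 1" "Suc a = q - 1"
        proof -
          have "y @ [Suc a] = butlast y @ [q - 1, q - 1]"
            using m append_butlast_last_id[OF m(1)] by (metis append_Cons append_Nil append_assoc)
          then show ?thesis using True n by (auto simp: debt_def)
        qed
        ultimately show ?thesis using t(6) True len by (auto simp: budget_def)
      next
        \<comment> \<open>At most three updates against budget 1: for r = 1 there is no old debt and
          3 <= 2 + 1, for r >= 2 the old debt is 1 and 3 + 1 <= 3 + 1.\<close>
        case False
        have "debt q n w \<le> (if r = 1 then 0 else 1)"
          using len a by (auto simp: debt_def w_eq)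
        moreover have "debt q n (y @ [Suc a]) = (if r = 1 then 2 else 3)"
          using n False by (auto simp: debt_def)
        ultimately show ?thesis using t(6) False len by (auto simp: budget_def split: if_splits)
      qed
      moreover have "w ! (length y mod length w) < q - 1" using a by (simp add: w_eq nth_append)
      moreover have "w ! (j mod length w) = q - 1" if "length y < j" "j < n" for j
        using that n len by (simp add: w_eq nth_append nth_Cons')
      ultimately show "?Q t" using t n regs len cells
        by (intro post[where l = "length y"]) (simp_all add: next_eq)
    qed (use cells regs a n len in \<open>simp_all add: w_eq\<close>)
    then show ?thesis using False regs by (simp add: lyndon_step_def)
  qed
qed

text \<open>Register 6 is initially 0, so the first command writes the word \<open>[0]\<close>. The
  loop stops on reaching \<open>[q - 1]\<close>, which remains to be emitted exactly when n =
  1.\<close>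

definition lyndon_program :: com where
  "lyndon_program =
     Seq append_letter (Seq (Assign 2 (Num 1))
     (Seq (While (Neg (IsRun (Num 0))) lyndon_step)
     (Cond (Less (Reg 2) (Reg 1)) Skip Emit)))"

lemma lyndon_program_correct:
  assumes "q \<ge> 2" "n \<ge> 1"
  shows "wp lyndon_program (\<lambda>s. enumerates_lyndon q n s \<and>
    updates s + 3 * sum_lyndon q n \<le> 3 * sumsum_lyndon q n + num_lyndon q n) (init_state q n)"
proof -
  let ?Q = "\<lambda>s. enumerates_lyndon q n s \<and>
    updates s + 3 * sum_lyndon q n \<le> 3 * sumsum_lyndon q n + num_lyndon q n"
  let ?e = "Cond (Less (Reg 2) (Reg 1)) Skip Emit"
  let ?s = "(init_state q n)\<lparr>cells := compress q [0], updates := 1,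
    regs := (regs (init_state q n))(2 := 1)\<rparr>"
  have "lyndon_inv q n ?s" using assms unfolding lyndon_inv_def
    by (intro exI[of _ "[0]"] exI[of _ "[]"])
      (auto simp: below_first init_state_def lyndon_upto_def lyndon_def)
  then have "wp (While (Neg (IsRun (Num 0))) lyndon_step) (wp ?e ?Q) ?s"
  proof (rule wp_While[where I = "lyndon_inv q n" and
        f = "\<lambda>s. card (lyndon_upto q n - below q n (decompress q (cells s)))"])
    fix s assume "lyndon_inv q n s" "bval (Neg (IsRun (Num 0))) s"
    then show "wp lyndon_step (\<lambda>t. lyndon_inv q n t \<and>
      card (lyndon_upto q n - below q n (decompress q (cells t)))
        < card (lyndon_upto q n - below q n (decompress q (cells s)))) s"
      by (intro wp_lyndon_step) auto
  next
    fix s assume inv: "lyndon_inv q n s" and run: "\<not> bval (Neg (IsRun (Num 0))) s"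
    obtain w ws where w: "w \<in> lyndon_upto q n" and cells: "cells s = compress q w"
      and regs: "regs s 0 = q" "regs s 1 = n" "regs s 2 = length w"
      and ws: "sorted_wrt lex_less ws" "set ws = {v \<in> below q n w. length v = n}"
      and emit: "emitted s = map (compress q) ws"
      and upd: "updates s \<le> Suc (debt q n w + (\<Sum>v\<in>below q n w. budget n v))"
      using inv unfolding lyndon_inv_def by blast
    have w': "lyndon w" "w \<noteq> []" "set w \<subseteq> {..<q}" and "length w \<le> n"
      using w by (auto simp: lyndon_upto_def)
    have w_eq: "w = [q - 1]"
      using lyndon_max_hd[OF w'] run cells compress_hd_run[OF w'(2), of q] by auto
    have below: "below q n w = lyndon_upto q n - {w}" by (simp only: w_eq below_last)
    \<comment> \<open>No update follows, so the budget of \<open>[q - 1]\<close> is free for the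
      debt and the initial update: 1 <= 1 for n = 1, 3 <= 3 for n = 2, and 4 <= 3 (n - 1)
      beyond.\<close>
    have "Suc (debt q n w) \<le> budget n w"
      using assms by (auto simp: w_eq debt_def budget_def)
    then have "updates s \<le> budget n w + (\<Sum>v\<in>below q n w. budget n v)" using upd by simp
    also have "\<dots> = (\<Sum>v\<in>lyndon_upto q n. budget n v)"
      unfolding below using w by (simp add: sum.remove[OF finite_lyndon_upto w])
    finally have "updates s + 3 * sum_lyndon q n \<le> 3 * sumsum_lyndon q n + num_lyndon q n"
      using sum_budget[OF assms(2), of q] by simp
    moreover have "enumerates_lyndon q n (if length w < n then s
        else s\<lparr>emitted := emitted s @ [cells s]\<rparr>)"
      unfolding enumerates_lyndon_def
    proof (intro exI conjI)
      let ?ws = "ws @ (if length w < n then [] else [w])"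
      show "sorted_wrt lex_less ?ws" using ws by (auto simp: sorted_wrt_append below_def)
      show "set ?ws = lyndon_words q n"
        using w ws(2) \<open>length w \<le> n\<close> by (auto simp: lyndon_words_eq_upto[OF assms(2)] below)
      show "emitted (if length w < n then s else s\<lparr>emitted := emitted s @ [cells s]\<rparr>)
          = map (compress q) ?ws" using emit cells by simp
    qed
    ultimately show "wp ?e ?Q s" using regs by auto
  qed
  moreover have "cells (init_state q n) = compress q []" "regs (init_state q n) 0 = q"
    "regs (init_state q n) 6 = 0" by (simp_all add: init_state_def)
  ultimately show ?thesis using assms(1)
    by (simp add: lyndon_program_def wp_append_letter[where q = q and u = "[]"]) (simp add: init_state_def)
qed

subsection \<open>Counting Lyndon words\<close>

text \<open>For k > 0 the word and its rotation would each be smaller than the other.\<close>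

lemma lyndon_rotate_imp_eq:
  assumes "lyndon w" "lyndon (rotate k w)" "k < length w"
  shows "k = 0"
proof (rule ccontr)
  assume "k \<noteq> 0"
  with assms(1,3) have "lex_less w (rotate k w)" by (simp add: lyndon_iff_rotate)
  moreover have "lex_less (rotate k w) (rotate (length w - k) (rotate k w))"
    using assms(2,3) \<open>k \<noteq> 0\<close> unfolding lyndon_iff_rotate length_rotate
    by (metis diff_less gr0I length_greater_0_conv less_nat_zero_code list.size(3) zero_less_diff)
  moreover have "rotate (length w - k) (rotate k w) = w"
    using assms(3) by (simp add: rotate_rotate)
  ultimately show False using lex_less_asym by metis
qed

lemma rotate_eq_imp:
  assumes "rotate i v = rotate j w" "i \<le> j" "j < length v" "length v = length w"
  shows "v = rotate (j - i) w"
proof -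
  let ?n = "length v"
  have "rotate (?n - i) (rotate i v) = rotate (?n - i) (rotate j w)" by (simp only: assms(1))
  then have "rotate ?n v = rotate (?n - i + j) w" using assms(2,3) by (simp add: rotate_rotate)
  also have "?n - i + j = (j - i) + length w" using assms(2-4) by simp
  also have "rotate (j - i + length w) w = rotate (j - i) w" 
    by (metis mod_add_self2 rotate_conv_mod)
  finally show ?thesis by simp
qed

text \<open>All \<open>n\<close> rotations of all Lyndon words of length \<open>n\<close> are
  distinct, since a coincidence would make one Lyndon word a rotation of another or of
  itself.\<close>

lemma num_lyndon_upper: "n * num_lyndon q n \<le> q ^ n"
proof -
  have "inj_on (\<lambda>(i, w). rotate i w) ({..<n} \<times> lyndon_words q n)"
  proof -
    have key: "i = j \<and> v = w" if "i \<le> j" "j < n" "v \<in> lyndon_words q n" "w \<in> lyndon_words q n"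
      "rotate i v = rotate j w" for i j v w
    proof -
      have "length v = n" "length w = n" "lyndon v" "lyndon w"
        using that by (auto simp: lyndon_words_def)
      moreover from this have "v = rotate (j - i) w" using rotate_eq_imp[of i v j w] that by simp
      moreover from calculation have "j - i = 0"
        using lyndon_rotate_imp_eq[of w "j - i"] that(2) by simp
      ultimately show ?thesis using that(1) by simp
    qed
    show ?thesis
    proof (rule inj_onI)
      fix x y assume *: "x \<in> {..<n} \<times> lyndon_words q n" "y \<in> {..<n} \<times> lyndon_words q n"
        "(\<lambda>(i, w). rotate i w) x = (\<lambda>(i, w). rotate i w) y"
      obtain i v j w where xy: "x = (i, v)" "y = (j, w)" by fastforce
      have ij: "i < n" "v \<in> lyndon_words q n" "j < n" "w \<in> lyndon_words q n"
        "rotate i v = rotate j w" using * by (simp_all add: xy)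
      show "x = y"
      proof (cases "i \<le> j")
        case True
        then show ?thesis using key[OF True ij(3,2,4,5)] by (simp add: xy)
      next
        case False
        then show ?thesis using key[OF _ ij(1,4,2) ij(5)[symmetric]] by (simp add: xy)
      qed
    qed
  qed
  moreover have "(\<lambda>(i, w). rotate i w) ` ({..<n} \<times> lyndon_words q n)
      \<subseteq> {w. set w \<subseteq> {..<q} \<and> length w = n}"
    by (auto simp: lyndon_words_def)
  ultimately have "card ({..<n} \<times> lyndon_words q n) \<le> card {w. set w \<subseteq> {..<q} \<and> length w = n}"
    by (intro card_inj_on_le) (simp_all add: finite_lists_length_eq)
  then show ?thesis
    by (simp add: num_lyndon_def card_lists_length_eq card_cartesian_product)
qed

lemma rotate_fixed_nth:
  assumes "rotate p w = w" "0 < p" "j < length w"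
  shows "w ! j = w ! (j mod p)"
  using assms(3)
proof (induction j rule: less_induct)
  case (less j)
  show ?case
  proof (cases "j < p")
    case False
    then have "rotate p w ! (j - p) = w ! j" using less.prems by (simp add: nth_rotate)
    then have "w ! j = w ! (j - p)" using assms(1) by simp
    also have "\<dots> = w ! ((j - p) mod p)" using less False assms(2) by simp
    finally show ?thesis using False by (simp add: le_mod_geq)
  qed simp
qed

text \<open>By \<open>rotate_fixed_nth\<close> such a word is determined by its first
  \<open>p\<close> letters.\<close>

lemma card_rotate_fixed:
  assumes "0 < p" "p \<le> n"
  shows "card {w. set w \<subseteq> {..<q} \<and> length w = n \<and> rotate p w = w} \<le> q ^ p"
proof -
  let ?A = "{w. set w \<subseteq> {..<q} \<and> length w = n \<and> rotate p w = w}"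
  have "inj_on (take p) ?A"
  proof (rule inj_onI)
    fix v w assume vw: "v \<in> ?A" "w \<in> ?A" "take p v = take p w"
    show "v = w"
    proof (rule nth_equalityI)
      fix j assume "j < length v"
      then have "v ! j = v ! (j mod p)" "w ! j = w ! (j mod p)"
        using rotate_fixed_nth[of p v j] rotate_fixed_nth[of p w j] vw(1,2) assms(1) by auto
      moreover have "v ! (j mod p) = w ! (j mod p)"
        using vw(3) assms(1) by (metis mod_less_divisor nth_take)
      ultimately show "v ! j = w ! j" by simp
    qed (use vw in simp)
  qed
  moreover have "take p ` ?A \<subseteq> {w. set w \<subseteq> {..<q} \<and> length w = p}"
    using assms(2) by (auto dest: in_set_takeD)
  ultimately have "card ?A \<le> card {w. set w \<subseteq> {..<q} \<and> length w = p}"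
    by (intro card_inj_on_le) (simp_all add: finite_lists_length_eq)
  then show ?thesis by (simp add: card_lists_length_eq)
qed

lemma ex_least_rotation:
  assumes "w \<noteq> []"
  shows "\<exists>i<length w. \<forall>j<length w. \<not> lex_less (rotate j w) (rotate i w)"
proof -
  let ?A = "(\<lambda>i. rotate i w) ` {..<length w}"
  have "asymp_on ?A lex_less" by (rule asymp_onI) (rule lex_less_asym)
  moreover have "transp_on ?A lex_less" by (rule transp_onI) (rule lex_less_trans)
  ultimately have "\<exists>m\<in>?A. \<forall>v\<in>?A. v \<noteq> m \<longrightarrow> \<not> lex_less v m"
    using assms by (intro Finite_Set.bex_min_element) (simp_all add: lessThan_empty_iff)
  then obtain i where "i < length w"
    "\<And>v. v \<in> ?A \<Longrightarrow> v \<noteq> rotate i w \<Longrightarrow> \<not> lex_less v (rotate i w)"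
    by blast
  then show ?thesis by (metis imageI lessThan_iff lex_less_irrefl)
qed

text \<open>A word of length \<open>n\<close> with pairwise distinct rotations is a rotation of a Lyndon word, and
  the other words are fixed by a rotation by some \<open>p \<le> n / 2\<close>.\<close>

lemma num_lyndon_lower:
  assumes "q \<ge> 1" "n \<ge> 1"
  shows "q ^ n \<le> n * q ^ (n div 2) + n * num_lyndon q n"
proof -
  let ?W = "{w. set w \<subseteq> {..<q} \<and> length w = n}"
  let ?F = "\<lambda>p. {w. set w \<subseteq> {..<q} \<and> length w = n \<and> rotate p w = w}"
  let ?R = "(\<lambda>(i, w). rotate i w) ` ({..<n} \<times> lyndon_words q n)"
  have fin: "finite ?W" by (simp add: finite_lists_length_eq)
  have "?W \<subseteq> (\<Union>p\<in>{1..n div 2}. ?F p) \<union> ?R"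
  proof (rule subsetI, rule UnCI)
    fix w assume w: "w \<in> ?W" and nF: "w \<notin> ?R"
    then have "w \<noteq> []" using assms(2) by auto
    then obtain i where i: "i < n" "\<And>j. j < n \<Longrightarrow> \<not> lex_less (rotate j w) (rotate i w)"
      using ex_least_rotation[of w] w by auto
    have "rotate (n - i) (rotate i w) = w" using i(1) w by (simp add: rotate_rotate)
    have nl: "\<not> lyndon (rotate i w)"
    proof
      assume l: "lyndon (rotate i w)"
      \<comment> \<open>The reduction modulo \<open>n\<close> serves the case i = 0, where
        \<open>n - i\<close> is outside the index range.\<close>
      have "w = rotate ((n - i) mod n) (rotate i w)"
        using \<open>rotate (n - i) (rotate i w) = w\<close> w
        by (metis (mono_tags, lifting) length_rotate mem_Collect_eq rotate_conv_mod)
      moreover have "rotate i w \<in> lyndon_words q n" using w l by (auto simp: lyndon_words_def)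
      moreover have "(n - i) mod n < n" using assms(2) by simp
      ultimately show False using nF by (metis (mono_tags, lifting) SigmaI case_prod_conv image_eqI lessThan_iff)
    qed
    then obtain k where k: "0 < k" "k < n" "\<not> lex_less (rotate i w) (rotate k (rotate i w))"
      using w unfolding lyndon_iff_rotate by auto
    have "rotate k (rotate i w) = rotate ((k + i) mod n) w"
      using w by (simp add: rotate_rotate) (metis rotate_conv_mod)
    moreover have "(k + i) mod n < n" using assms(2) by simp
    \<comment> \<open>The rotation by \<open>i\<close> is least and yet not smaller than this one,
      so the two coincide.\<close>
    ultimately have "rotate k (rotate i w) = rotate i w"
      using i(2) k(3) lex_less_total by metis
    then have "rotate (n - i) (rotate k (rotate i w)) = w"
      using \<open>rotate (n - i) (rotate i w) = w\<close> by simp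
    then have "rotate k (rotate (n - i) (rotate i w)) = w" by (simp add: rotate_rotate add.commute add.left_commute)
    then have fix_k: "rotate k w = w" using \<open>rotate (n - i) (rotate i w) = w\<close> by simp
    then have "rotate (n - k) (rotate k w) = rotate (n - k) w" by simp
    then have fix_nk: "rotate (n - k) w = w" using k w by (simp add: rotate_rotate)
    \<comment> \<open>Both \<open>k\<close> and \<open>n - k\<close> fix \<open>w\<close>, and the
      smaller is at most n / 2.\<close>
    define p where "p = min k (n - k)"
    have "p \<in> {1..n div 2}" "rotate p w = w"
      using k fix_k fix_nk by (auto simp: p_def min_def)
    then show "w \<in> (\<Union>p\<in>{1..n div 2}. ?F p)" using w by blast
  qed
  then have "card ?W \<le> card ((\<Union>p\<in>{1..n div 2}. ?F p) \<union> ?R)"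
    by (intro card_mono) (auto intro: finite_subset[OF _ fin] simp: finite_lyndon_words)
  also have "\<dots> \<le> card (\<Union>p\<in>{1..n div 2}. ?F p) + card ?R" by (rule card_Un_le)
  also have "card ?R \<le> card ({..<n} \<times> lyndon_words q n)"
    by (rule card_image_le) (simp add: finite_lyndon_words)
  also have "card (\<Union>p\<in>{1..n div 2}. ?F p) \<le> (\<Sum>p=1..n div 2. card (?F p))"
    by (rule card_UN_le) simp
  also have "(\<Sum>p=1..n div 2. card (?F p)) \<le> (\<Sum>p=1..n div 2. q ^ (n div 2))"
  proof (rule sum_mono)
    fix p assume p: "p \<in> {1..n div 2}"
    then have "card (?F p) \<le> q ^ p" by (intro card_rotate_fixed) auto
    also have "\<dots> \<le> q ^ (n div 2)" using p assms(1) by (intro power_increasing) auto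
    finally show "card (?F p) \<le> q ^ (n div 2)" .
  qed
  also have "\<dots> \<le> n * q ^ (n div 2)" by simp
  finally show ?thesis
    by (simp add: num_lyndon_def card_lists_length_eq card_cartesian_product)
qed

section \<open>Asymptotics of the number of Lyndon words and of the update bound\<close>

text \<open>The proportion of words of length \<open>n\<close> that are rotations of Lyndon words,
  by the injectivity in \<open>num_lyndon_upper\<close>.\<close>

definition lyndon_density :: "nat \<Rightarrow> nat \<Rightarrow> real" where
  "lyndon_density q n = real (n * num_lyndon q n) / real q ^ n"

lemma lyndon_density_le_1: "q \<ge> 1 \<Longrightarrow> lyndon_density q n \<le> 1"
  using num_lyndon_upper[of n q] unfolding lyndon_density_def
  by (simp del: of_nat_mult flip: of_nat_power add: divide_le_eq)

lemma lyndon_density_tendsto: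
  assumes "q \<ge> 2"
  shows "(\<lambda>n. lyndon_density q n) \<longlonglongrightarrow> 1"
proof (rule tendsto_sandwich)
  show "eventually (\<lambda>n. lyndon_density q n \<le> 1) sequentially"
    using lyndon_density_le_1 assms by simp
  \<comment> \<open>The defect in \<open>num_lyndon_lower\<close> is n / q^(n - n div 2) after
    division, where q >= 2 and n - n div 2 >= n / 2.\<close>
  show "eventually (\<lambda>n. 1 - real n / 2 powr (real n / 2) \<le> lyndon_density q n) sequentially"
    using eventually_ge_at_top[of 1]
  proof eventually_elim
    case (elim n)
    have "real (q ^ n) \<le> real (n * q ^ (n div 2) + n * num_lyndon q n)"
      using num_lyndon_lower[of q n] assms elim by (subst of_nat_le_iff) auto
    then have "real q ^ n \<le> real n * real q ^ (n div 2) + real (n * num_lyndon q n)" by simp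
    then have "1 - real n * (real q ^ (n div 2) / real q ^ n) \<le> lyndon_density q n"
      using assms by (simp add: lyndon_density_def le_divide_eq algebra_simps)
    moreover have "real q ^ (n div 2) / real q ^ n \<le> 1 / 2 powr (real n / 2)"
    proof -
      have "real q ^ (n div 2) / real q ^ n = 1 / real q ^ (n - n div 2)"
        using assms by (simp add: power_diff)
      also have "\<dots> \<le> 1 / 2 ^ (n - n div 2)"
        using assms by (intro divide_left_mono power_mono) auto
      also have "\<dots> = 1 / 2 powr real (n - n div 2)" by (subst powr_realpow) auto
      also have "\<dots> \<le> 1 / 2 powr (real n / 2)"
        by (intro divide_left_mono powr_mono) (auto simp: of_nat_diff)
      finally show ?thesis .
    qed
    then have "real n * (real q ^ (n div 2) / real q ^ n) \<le> real n * (1 / 2 powr (real n / 2))"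
      by (rule mult_left_mono) simp
    ultimately show ?case by simp
  qed
  show "(\<lambda>n. 1 - real n / 2 powr (real n / 2)) \<longlonglongrightarrow> 1" by real_asymp
qed simp

text \<open>For fixed \<open>k\<close> the density quotient and n / (n - k) tend to 1, which exposes
  the limit 1 / q^k.\<close>

lemma num_lyndon_ratio:
  assumes "q \<ge> 2" "k < n" "lyndon_density q n > 0"
  shows "real (num_lyndon q (n - k)) / real (num_lyndon q n)
    = lyndon_density q (n - k) / lyndon_density q n * (real n / (real n - real k)) * (1 / real q) ^ k"
proof -
  have "real (num_lyndon q m) = lyndon_density q m * real q ^ m / real m" if "m > 0" for m
    using that assms(1) by (simp add: lyndon_density_def)
  note num = this
  have "real q ^ n = real q ^ (n - k) * real q ^ k"
    using assms(2) by (simp flip: power_add)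
  moreover have "real n - real k > 0" "real q ^ (n - k) > 0" "real q ^ k > 0" using assms by auto
  ultimately show ?thesis using assms
    by (simp add: num of_nat_diff power_one_over divide_simps)
qed

lemma sum_num_lyndon_ratio_tendsto:
  assumes q: "q \<ge> 2"
  shows "(\<lambda>n. (\<Sum>k<n. real k * real (num_lyndon q (n - k))) / real (num_lyndon q n))
    \<longlonglongrightarrow> real q / (real q - 1)\<^sup>2"
proof -
  define a where "a k n = (if k < n
    then real k * (real (num_lyndon q (n - k)) / real (num_lyndon q n)) else 0)" for k n
  define b where "b k = real k * (1 / real q) ^ k" for k
  \<comment> \<open>A density above 1/2 bounds the density quotient by 2; moreover n / (n - k) <= k
    + 1 for k < n, and 1 / q <= 1/2.\<close>
  define M :: "nat \<Rightarrow> real" where "M k = 2 * real k * (real k + 1) * (1 / 2) ^ k" for k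
  have half: "eventually (\<lambda>n. lyndon_density q n > 1 / 2) sequentially"
    by (rule order_tendstoD[OF lyndon_density_tendsto[OF q]]) simp
  have lim: "(\<lambda>n. a k n) \<longlonglongrightarrow> b k" for k
  proof (rule Lim_transform_eventually)
    have "(\<lambda>n. lyndon_density q (n - k)) \<longlonglongrightarrow> 1"
      by (rule filterlim_compose[OF lyndon_density_tendsto[OF q] filterlim_minus_const_nat_at_top])
    moreover have "(\<lambda>n. real n / (real n - real k)) \<longlonglongrightarrow> 1" by real_asymp
    ultimately have "(\<lambda>n. real k * (lyndon_density q (n - k) / lyndon_density q n *
        (real n / (real n - real k)) * (1 / real q) ^ k)) \<longlonglongrightarrow> real k * (1 / 1 * 1 * (1 / real q) ^ k)"
      by (intro tendsto_intros lyndon_density_tendsto[OF q]) auto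
    then show "(\<lambda>n. real k * (lyndon_density q (n - k) / lyndon_density q n *
        (real n / (real n - real k)) * (1 / real q) ^ k)) \<longlonglongrightarrow> b k" by (simp add: b_def)
    show "eventually (\<lambda>n. real k * (lyndon_density q (n - k) / lyndon_density q n *
        (real n / (real n - real k)) * (1 / real q) ^ k) = a k n) sequentially"
      using half eventually_gt_at_top[of k]
      by eventually_elim (use q in \<open>simp add: a_def num_lyndon_ratio\<close>)
  qed
  have bound: "norm (a k n) \<le> M k" if n: "lyndon_density q n > 1 / 2" for k n
  proof (cases "k < n")
    case True
    let ?d = "lyndon_density q"
    have "?d (n - k) / ?d n \<le> 1 / (1 / 2)"
      using n lyndon_density_le_1[of q "n - k"] q by (intro frac_le) auto
    moreover have "real n / (real n - real k) \<le> real k + 1"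
    proof -
      \<comment> \<open>This is n <= (k + 1) (n - k) multiplied out.\<close>
      have "k * (k + 1) \<le> k * n" using True by (intro mult_le_mono2) simp
      then have "real k * (real k + 1) \<le> real k * real n"
        by (metis of_nat_1 of_nat_add of_nat_le_iff of_nat_mult)
      then show ?thesis using True by (simp add: field_simps)
    qed
    moreover have "(1 / real q) ^ k \<le> (1 / 2) ^ k" using q by (intro power_mono frac_le) auto
    ultimately have "?d (n - k) / ?d n * (real n / (real n - real k)) * (1 / real q) ^ k
        \<le> 1 / (1 / 2) * (real k + 1) * (1 / 2) ^ k"
      using True by (intro mult_mono) auto
    moreover have "a k n = real k *
        (?d (n - k) / ?d n * (real n / (real n - real k)) * (1 / real q) ^ k)"
      using True n q by (simp add: a_def num_lyndon_ratio)
    ultimately have "a k n \<le> real k * (1 / (1 / 2) * (real k + 1) * (1 / 2) ^ k)"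
      by (simp only: mult_left_mono of_nat_0_le_iff)
    moreover have "a k n \<ge> 0" by (simp add: a_def)
    ultimately show ?thesis by (simp add: M_def algebra_simps)
  qed (simp add: a_def M_def)
  have "eventually (\<lambda>x. True \<and> lyndon_density q (snd x) > 1 / 2) (at_top \<times>\<^sub>F sequentially)"
    by (rule eventually_prodI[OF _ half, of "\<lambda>_. True"]) simp
  then have ev: "eventually (\<lambda>(k, n). norm (a k n) \<le> M k) (at_top \<times>\<^sub>F sequentially)"
    by (rule eventually_mono) (clarify, rule bound, simp)
  have "summable M"
  proof (rule summable_comparison_test_bigo)
    \<comment> \<open>A ratio strictly between 1/2 and 1 absorbs the polynomial factor of
      \<open>M\<close>.\<close>
    show "summable (\<lambda>n. norm ((3 / 4 :: real) ^ n))" by (simp add: summable_geometric)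
    show "M \<in> O(\<lambda>n. (3 / 4) ^ n)" unfolding M_def by real_asymp
  qed
  with tannerys_theorem[OF lim ev] have "(\<lambda>n. suminf (\<lambda>k. a k n)) \<longlonglongrightarrow> suminf b" by simp
  moreover have "suminf (\<lambda>k. a k n)
      = (\<Sum>k<n. real k * real (num_lyndon q (n - k))) / real (num_lyndon q n)" for n
  proof -
    have "suminf (\<lambda>k. a k n) = (\<Sum>k<n. a k n)" by (rule suminf_finite) (auto simp: a_def)
    also have "\<dots> = (\<Sum>k<n. real k * real (num_lyndon q (n - k)) / real (num_lyndon q n))"
      by (rule sum.cong) (auto simp: a_def)
    finally show ?thesis by (simp add: sum_divide_distrib)
  qed
  moreover have "suminf b = real q / (real q - 1)\<^sup>2"
  proof -
    \<comment> \<open>The derivative of the geometric series at 1 / q; multiplying by 1 / q and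
      shifting the index gives the sum of k / q^k.\<close>
    have "(\<lambda>n. of_nat (Suc n) * (1 / real q) ^ n) sums (1 / (1 - 1 / real q)\<^sup>2)"
      using q by (intro geometric_deriv_sums) simp
    then have "(\<lambda>n. of_nat (Suc n) * (1 / real q) ^ n * (1 / real q))
        sums (1 / (1 - 1 / real q)\<^sup>2 * (1 / real q))" by (rule sums_mult2)
    then have "(\<lambda>n. b (Suc n)) sums (1 / (1 - 1 / real q)\<^sup>2 * (1 / real q))"
      by (simp add: b_def mult_ac)
    then have "b sums (1 / (1 - 1 / real q)\<^sup>2 * (1 / real q) + b 0)" by (rule sums_Suc)
    moreover have "1 / (1 - 1 / real q)\<^sup>2 * (1 / real q) + b 0 = real q / (real q - 1)\<^sup>2"
    proof -
      have "1 - 1 / real q = (real q - 1) / real q" using q by (simp add: field_simps)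
      then show ?thesis using q by (simp add: b_def power_divide power2_eq_square)
    qed
    ultimately show ?thesis using sums_unique by metis
  qed
  ultimately show ?thesis by simp
qed

lemma sumsum_minus_sum_lyndon:
  "real (sumsum_lyndon q n) - real (sum_lyndon q n) = (\<Sum>k<n. real k * real (num_lyndon q (n - k)))"
proof -
  have "(\<Sum>k=1..n. (n - k) * num_lyndon q k) = (\<Sum>k<n. k * num_lyndon q (n - k))"
    by (rule sum.reindex_bij_witness[of _ "\<lambda>k. n - k" "\<lambda>k. n - k"]) auto
  then show ?thesis by (simp add: sumsum_lyndon_eq)
qed

theorem theorem4:
  shows "(\<exists>P :: com. \<forall>q \<ge> 2. \<forall>n \<ge> 1. \<exists>s :: state.
            exec P (init_state q n) s \<and>
            enumerates_lyndon q n s \<and>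
            real (updates s) / real (num_lyndon q n) \<le>
              (3 * (real (sumsum_lyndon q n) - real (sum_lyndon q n)) + real (num_lyndon q n))
                / real (num_lyndon q n)) \<and>
         (\<forall>q :: nat. q \<ge> 2 \<longrightarrow>
            (\<lambda>n. (3 * (real (sumsum_lyndon q n) - real (sum_lyndon q n)) + real (num_lyndon q n))
                / real (num_lyndon q n)
              - (1 + 3 * real q / (real q - 1)\<^sup>2)) \<in> o(\<lambda>_. 1))"
proof (intro conjI exI[of _ lyndon_program] allI impI)
  fix q n :: nat assume "q \<ge> 2" "n \<ge> 1"
  then obtain s where s: "exec lyndon_program (init_state q n) s" "enumerates_lyndon q n s"
    and upd: "updates s + 3 * sum_lyndon q n \<le> 3 * sumsum_lyndon q n + num_lyndon q n"
    using lyndon_program_correct[of q n] unfolding wp_def by blast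
  from upd have "real (updates s)
      \<le> 3 * (real (sumsum_lyndon q n) - real (sum_lyndon q n)) + real (num_lyndon q n)" by simp
  then have "real (updates s) / real (num_lyndon q n) \<le>
      (3 * (real (sumsum_lyndon q n) - real (sum_lyndon q n)) + real (num_lyndon q n))
        / real (num_lyndon q n)"
    by (rule divide_right_mono) simp
  with s show "\<exists>s. exec lyndon_program (init_state q n) s \<and> enumerates_lyndon q n s \<and>
      real (updates s) / real (num_lyndon q n) \<le>
        (3 * (real (sumsum_lyndon q n) - real (sum_lyndon q n)) + real (num_lyndon q n))
          / real (num_lyndon q n)" by blast
next
  fix q :: nat assume q: "q \<ge> 2"
  let ?S = "\<lambda>n. real (sumsum_lyndon q n) - real (sum_lyndon q n)"
  have "(\<lambda>n. 3 * (?S n / real (num_lyndon q n)) - 3 * (real q / (real q - 1)\<^sup>2))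
      \<longlonglongrightarrow> 3 * (real q / (real q - 1)\<^sup>2) - 3 * (real q / (real q - 1)\<^sup>2)"
    unfolding sumsum_minus_sum_lyndon
    by (intro tendsto_intros sum_num_lyndon_ratio_tendsto q)
  then have "(\<lambda>n. 3 * (?S n / real (num_lyndon q n)) - 3 * (real q / (real q - 1)\<^sup>2)) \<longlonglongrightarrow> 0"
    by simp
  moreover have "eventually (\<lambda>n. 3 * (?S n / real (num_lyndon q n)) - 3 * (real q / (real q - 1)\<^sup>2)
      = (3 * ?S n + real (num_lyndon q n)) / real (num_lyndon q n)
        - (1 + 3 * real q / (real q - 1)\<^sup>2)) sequentially"
  proof -
    \<comment> \<open>The constant 1 arises as l_n / l_n, so l_n has to be nonzero, which positive
      density ensures for large \<open>n\<close>.\<close>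
    have "eventually (\<lambda>n. lyndon_density q n > 0) sequentially"
      by (rule order_tendstoD[OF lyndon_density_tendsto[OF q]]) simp
    then show ?thesis
    proof eventually_elim
      case (elim n)
      then have "num_lyndon q n \<noteq> 0" by (intro notI) (simp add: lyndon_density_def)
      then show ?case by (simp add: add_divide_distrib)
    qed
  qed
  ultimately have "(\<lambda>n. (3 * ?S n + real (num_lyndon q n)) / real (num_lyndon q n)
      - (1 + 3 * real q / (real q - 1)\<^sup>2)) \<longlonglongrightarrow> 0"
    by (rule Lim_transform_eventually)
  then show "(\<lambda>n. (3 * ?S n + real (num_lyndon q n)) / real (num_lyndon q n)
      - (1 + 3 * real q / (real q - 1)\<^sup>2)) \<in> o(\<lambda>_. 1)"
    by (intro smalloI_tendsto) simp_all
qed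

end
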